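(* Let $\phi=\tilde p/p$ be a rational inner function on $\mathbb{D}^2$ with $\deg p=(m,n)$, and let $0<\mathfrak p<\infty$. If $\frac{\partial\phi}{\partial z_1}\in H^{\mathfrak p}(\mathbb{D}^2)$, then $\phi\in\mathfrak{D}_{(\mathfrak p,0)}$; and if $\frac{\partial\phi}{\partial z_2}\in H^{\mathfrak p}(\mathbb{D}^2)$, then $\phi\in\mathfrak{D}_{(0,\mathfrak p)}$.
   Context: $\phi=\tilde p/p$ where $p\in\mathbb{C}[z_1,z_2]$ has bidegree $(m,n)$, no zeros in $\mathbb{D}^2$, is atoral, and $\tilde p(z)=z_1^mz_2^n\overline{p(1/\bar z_1,1/\bar z_2)}$. $H^{\mathfrak p}(\mathbb{D}^2)$: holomorphic $f$ with $\sup_{0<r<1}\frac1{4\pi^2}\int_{\mathbb{T}^2}|f(r\zeta)|^{\mathfrak p}|d\zeta|<\infty$. For $\vec\alpha=(\alpha_1,\alpha_2)\in\mathbb{R}^2$, the anisotropic Dirichlet-type space $\mathfrak D_{\vec\alpha}$ consists of holomorphic $f(z)=\sum_{k,\ell\ge0}a_{k\ell}z_1^kz_2^\ell$ on $\mathbb{D}^2$ with $\|f\|^2_{\mathfrak D_{\vec\alpha}}=\sum_{k,\ell\ge0}(k+1)^{\alpha_1}(\ell+1)^{\alpha_2}|a_{k\ell}|^2<\infty$. *)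

theory Defs
  imports "HOL-Analysis.Analysis"
begin

definition bipoly :: "(nat \<Rightarrow> nat \<Rightarrow> complex) \<Rightarrow> nat \<Rightarrow> nat \<Rightarrow> complex \<Rightarrow> complex \<Rightarrow> complex" where
  "bipoly c m n z1 z2 = (\<Sum>j\<le>m. \<Sum>k\<le>n. c j k * z1 ^ j * z2 ^ k)"

definition has_bidegree :: "(nat \<Rightarrow> nat \<Rightarrow> complex) \<Rightarrow> nat \<Rightarrow> nat \<Rightarrow> bool" where
  "has_bidegree c m n \<longleftrightarrow>
     (\<forall>j k. (m < j \<or> n < k) \<longrightarrow> c j k = 0) \<and> (\<exists>k. c m k \<noteq> 0) \<and> (\<exists>j. c j n \<noteq> 0)"

text \<open>Coefficients of the reflection p~(z) = z1^m z2^n conj(p(1/conj z1, 1/conj z2)).\<close>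
definition refl_coeff :: "(nat \<Rightarrow> nat \<Rightarrow> complex) \<Rightarrow> nat \<Rightarrow> nat \<Rightarrow> nat \<Rightarrow> nat \<Rightarrow> complex" where
  "refl_coeff c m n j k = (if j \<le> m \<and> k \<le> n then cnj (c (m - j) (n - k)) else 0)"

definition is_polyfun :: "(complex \<Rightarrow> complex \<Rightarrow> complex) \<Rightarrow> bool" where
  "is_polyfun f \<longleftrightarrow> (\<exists>d N. \<forall>z1 z2. f z1 z2 = bipoly d N N z1 z2)"

definition atoral :: "(nat \<Rightarrow> nat \<Rightarrow> complex) \<Rightarrow> nat \<Rightarrow> nat \<Rightarrow> bool" where
  "atoral c m n \<longleftrightarrow> \<not> (\<exists>q r s. is_polyfun q \<and> is_polyfun r \<and> is_polyfun s \<and>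
      \<not> (\<exists>a. \<forall>z1 z2. q z1 z2 = a) \<and>
      (\<forall>z1 z2. bipoly c m n z1 z2 = q z1 z2 * r z1 z2) \<and>
      (\<forall>z1 z2. bipoly (refl_coeff c m n) m n z1 z2 = q z1 z2 * s z1 z2))"

definition no_zeros_bidisc :: "(nat \<Rightarrow> nat \<Rightarrow> complex) \<Rightarrow> nat \<Rightarrow> nat \<Rightarrow> bool" where
  "no_zeros_bidisc c m n \<longleftrightarrow> (\<forall>z1 z2. norm z1 < 1 \<longrightarrow> norm z2 < 1 \<longrightarrow> bipoly c m n z1 z2 \<noteq> 0)"

definition holo_bidisc :: "(complex \<Rightarrow> complex \<Rightarrow> complex) \<Rightarrow> bool" where
  "holo_bidisc f \<longleftrightarrow> continuous_on (ball 0 1 \<times> ball 0 1) (\<lambda>(z, w). f z w) \<and>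
     (\<forall>w\<in>ball 0 1. (\<lambda>z. f z w) holomorphic_on ball 0 1) \<and>
     (\<forall>z\<in>ball 0 1. (\<lambda>w. f z w) holomorphic_on ball 0 1)"

definition hardy2 :: "real \<Rightarrow> (complex \<Rightarrow> complex \<Rightarrow> complex) \<Rightarrow> bool" where
  "hardy2 P f \<longleftrightarrow> holo_bidisc f \<and>
     bdd_above ((\<lambda>r. (1 / (4 * pi ^ 2)) *
        (LBINT s=0..2*pi. (LBINT t=0..2*pi.
            norm (f (of_real r * cis s) (of_real r * cis t)) powr P))) ` {0<..<1})"

definition taylor2 :: "(complex \<Rightarrow> complex \<Rightarrow> complex) \<Rightarrow> nat \<Rightarrow> nat \<Rightarrow> complex" where
  "taylor2 f k l = (deriv ^^ k) (\<lambda>z1. (deriv ^^ l) (\<lambda>z2. f z1 z2) 0) 0 / (fact k * fact l)"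

definition dirichlet2 :: "real \<Rightarrow> real \<Rightarrow> (complex \<Rightarrow> complex \<Rightarrow> complex) \<Rightarrow> bool" where
  "dirichlet2 a1 a2 f \<longleftrightarrow> holo_bidisc f \<and>
     (\<lambda>(k, l). (real k + 1) powr a1 * (real l + 1) powr a2 * (norm (taylor2 f k l))\<^sup>2)
        summable_on (UNIV :: (nat \<times> nat) set)"

definition d1 :: "(complex \<Rightarrow> complex \<Rightarrow> complex) \<Rightarrow> complex \<Rightarrow> complex \<Rightarrow> complex" where
  "d1 f z1 z2 = deriv (\<lambda>w. f w z2) z1"

definition d2 :: "(complex \<Rightarrow> complex \<Rightarrow> complex) \<Rightarrow> complex \<Rightarrow> complex \<Rightarrow> complex" where
  "d2 f z1 z2 = deriv (\<lambda>w. f z1 w) z2"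

end

(*
  For eta on the unit circle the slice phi(., eta) is, up to a unimodular constant, a finite Blaschke
  product B of degree at most m.  Let eps be the distance of its zeros to the circle.  The disc of
  radius 1 + eps/2 is mapped by B into a disc of radius 7^m with bounded multiplicity, so the sum of
  k |b_k|^2 (1 + eps/2)^(2k) is bounded in terms of m; hence the sum of k^p |b_k|^2 is at most a
  constant times eps^(1-p) if p > 1, and bounded if p <= 1.  Conversely, on the circle |B'| is the sum
  of the Poisson kernels of the zeros, which is at least 1/(4 eps) on an arc of length eps; therefore
  eps^(1-p) is at most 4^p times the integral of |B'|^p.  Integrating over eta (Parseval in the second
  variable, Fatou for the radial limits) gives the claim.
*)
theory Submission
  imports Defs "HOL-Complex_Analysis.Complex_Analysis"
    "HOL-Computational_Algebra.Fundamental_Theorem_Algebra"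
begin

subsection \<open>Parseval's identity on the circle\<close>

text \<open>One constant must serve all slices: if p vanishes somewhere on the torus, zeros of the
  slices approach the circle as eta varies. So each slice enters only through the number eps^(1-p).
  The zero nearest to the circle already gives the lower bound, because the Poisson kernels are
  positive and cannot cancel. The energy is not computed as an area. Parseval turns the sum of k
  |b_k|^2 R^(2k) into the mean of z B' conj(B) over the circle of radius R, and this is at most R
  times sup |B| times the mean of |B'|. All poles lie beyond 1 + eps; the radius R = 1 + eps/2 keeps
  both factors bounded in terms of m. Atorality enters through the slices: if p(., eta) vanished
  identically for some eta on the circle, z2 - eta would divide both p and its reflection. Once this
  is excluded, Hurwitz's theorem rules out zeros of p with |z1| < 1 and |z2| = 1. In particular p(0,
  .) is zero-free on the closed disc, so every z1-coefficient of phi is holomorphic across |z2| = 1,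
  and Parseval in the second variable needs no limit.\<close>

lemma integral_cis_orthogonal:
  "integral {0..2*pi} (\<lambda>\<theta>. cis (real k * \<theta>) * cnj (cis (real l * \<theta>))) = (if k = l then 2 * pi else 0)"
proof (cases "k = l")
  case True
  then show ?thesis by (simp add: cis_cnj cis_mult scaleR_conv_of_real)
next
  case False
  define d where "d = real k - real l"
  have d: "d \<noteq> 0" using False by (simp add: d_def)
  have eq: "cis (real k * \<theta>) * cnj (cis (real l * \<theta>)) = cis (d * \<theta>)" for \<theta>
    by (simp add: cis_cnj cis_mult d_def algebra_simps)
  have "((\<lambda>\<theta>. cis (d * \<theta>)) has_integral (cis (d * (2*pi)) / (\<i> * d) - cis (d * 0) / (\<i> * d))) {0..2*pi}"
    by (rule fundamental_theorem_of_calculus)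
       (use d in \<open>auto simp: cis_conv_exp field_simps has_real_derivative_iff_has_vector_derivative [symmetric]
           intro!: derivative_eq_intros has_vector_derivative_real_field\<close>)
  moreover have "cis (d * (2*pi)) = 1"
  proof -
    have "d = of_int (int k - int l)" by (simp add: d_def)
    then show ?thesis by (metis cis_multiple_2pi Ints_of_int mult.commute)
  qed
  ultimately show ?thesis using False unfolding eq by (simp add: integral_unique)
qed

text \<open>Absolute summability makes the convergence uniform (Weierstrass test), so the series may
  be integrated term by term against a continuous \<open>g\<close>. Continuity of \<open>X\<close>
  comes from the same uniform limit.\<close>

lemma fourier_series_integral_sums:
  fixes x :: "nat \<Rightarrow> complex"
  assumes x: "summable (\<lambda>k. norm (x k))"
    and X: "\<And>\<theta>. (\<lambda>k. x k * cis (real k * \<theta>)) sums X \<theta>"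
    and g: "continuous_on {0..2*pi} g"
  shows "(\<lambda>k. x k * integral {0..2*pi} (\<lambda>\<theta>. cis (real k * \<theta>) * g \<theta>)) sums
           integral {0..2*pi} (\<lambda>\<theta>. X \<theta> * g \<theta>)"
    and "continuous_on UNIV X"
proof -
  have XX: "X = (\<lambda>\<theta>. \<Sum>k. x k * cis (real k * \<theta>))"
    using X by (auto simp: sums_iff)
  have ul: "uniform_limit UNIV (\<lambda>n \<theta>. \<Sum>k<n. x k * cis (real k * \<theta>)) X sequentially"
    unfolding XX by (rule Weierstrass_m_test[OF _ x]) (simp add: norm_mult)
  show cX: "continuous_on UNIV X"
    by (rule uniform_limit_theorem[OF _ ul])
       (auto intro!: always_eventually continuous_intros)
  have bg: "bounded (g ` {0..2*pi})"
    using compact_continuous_image[OF g] compact_imp_bounded by blast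
  have bX: "bounded (X ` {0..2*pi})"
    by (rule compact_imp_bounded[OF compact_continuous_image])
       (auto intro: continuous_on_subset[OF cX])
  have "uniform_limit {0..2*pi} (\<lambda>n \<theta>. (\<Sum>k<n. x k * cis (real k * \<theta>)) * g \<theta>) (\<lambda>\<theta>. X \<theta> * g \<theta>) sequentially"
    by (rule uniform_lim_mult[OF uniform_limit_on_subset[OF ul] uniform_limit_const bX bg]) auto
  then have "((\<lambda>n. integral {0..2*pi} (\<lambda>\<theta>. (\<Sum>k<n. x k * cis (real k * \<theta>)) * g \<theta>)) \<longlongrightarrow>
       integral {0..2*pi} (\<lambda>\<theta>. X \<theta> * g \<theta>)) sequentially"
    by (rule uniform_limit_integral) (auto simp: has_integral_iff intro!: continuous_intros g)
  moreover have "integral {0..2*pi} (\<lambda>\<theta>. (\<Sum>k<n. x k * cis (real k * \<theta>)) * g \<theta>) =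
      (\<Sum>k<n. x k * integral {0..2*pi} (\<lambda>\<theta>. cis (real k * \<theta>) * g \<theta>))" for n
  proof -
    have "integral {0..2*pi} (\<lambda>\<theta>. \<Sum>k<n. x k * (cis (real k * \<theta>) * g \<theta>)) =
       (\<Sum>k<n. integral {0..2*pi} (\<lambda>\<theta>. x k * (cis (real k * \<theta>) * g \<theta>)))"
      by (intro integral_sum integrable_continuous_interval continuous_intros g) auto
    then show ?thesis by (simp add: sum_distrib_right mult.assoc)
  qed
  ultimately show "(\<lambda>k. x k * integral {0..2*pi} (\<lambda>\<theta>. cis (real k * \<theta>) * g \<theta>)) sums
           integral {0..2*pi} (\<lambda>\<theta>. X \<theta> * g \<theta>)"
    by (simp add: sums_def)
qed

text \<open>Two term-by-term integrations: \<open>Y\<close> against exponentials identifies its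
  Fourier coefficients, then \<open>X\<close> is integrated against the conjugate of
  \<open>Y\<close>. The polarised form is needed because the energy pairs the coefficients of z B'
  with those of B.\<close>

lemma parseval_sums:
  fixes x y :: "nat \<Rightarrow> complex"
  assumes x: "summable (\<lambda>k. norm (x k))" and y: "summable (\<lambda>k. norm (y k))"
    and X: "\<And>\<theta>. (\<lambda>k. x k * cis (real k * \<theta>)) sums X \<theta>"
    and Y: "\<And>\<theta>. (\<lambda>k. y k * cis (real k * \<theta>)) sums Y \<theta>"
  shows "(\<lambda>k. 2 * pi * (x k * cnj (y k))) sums integral {0..2*pi} (\<lambda>\<theta>. X \<theta> * cnj (Y \<theta>))"
proof -
  have cY: "continuous_on UNIV Y"
    by (rule fourier_series_integral_sums(2)[OF y Y, of "\<lambda>_. 0"]) auto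
  have coeff: "integral {0..2*pi} (\<lambda>\<theta>. cis (real k * \<theta>) * cnj (Y \<theta>)) = 2 * pi * cnj (y k)" for k
  proof -
    have "(\<lambda>l. y l * integral {0..2*pi} (\<lambda>\<theta>. cis (real l * \<theta>) * cnj (cis (real k * \<theta>)))) sums
        integral {0..2*pi} (\<lambda>\<theta>. Y \<theta> * cnj (cis (real k * \<theta>)))"
      by (rule fourier_series_integral_sums(1)[OF y Y]) (intro continuous_intros)
    moreover have "(\<lambda>l. y l * integral {0..2*pi} (\<lambda>\<theta>. cis (real l * \<theta>) * cnj (cis (real k * \<theta>)))) sums
        (y k * (2 * pi))"
      unfolding integral_cis_orthogonal
      using sums_single[of k "\<lambda>l. y l * (2*pi)"] by (simp add: if_distrib cong: if_cong)
    ultimately have "integral {0..2*pi} (\<lambda>\<theta>. Y \<theta> * cnj (cis (real k * \<theta>))) = y k * (2 * pi)"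
      using sums_unique2 by blast
    then have "cnj (integral {0..2*pi} (\<lambda>\<theta>. Y \<theta> * cnj (cis (real k * \<theta>)))) = 2 * pi * cnj (y k)"
      by simp
    then show ?thesis by (simp add: integral_cnj mult.commute)
  qed
  have "(\<lambda>k. x k * integral {0..2*pi} (\<lambda>\<theta>. cis (real k * \<theta>) * cnj (Y \<theta>))) sums
           integral {0..2*pi} (\<lambda>\<theta>. X \<theta> * cnj (Y \<theta>))"
    by (rule fourier_series_integral_sums(1)[OF x X])
       (intro continuous_intros continuous_on_subset[OF cY] subset_UNIV)
  then show ?thesis unfolding coeff by (simp add: mult_ac)
qed

subsection \<open>Finite Blaschke products\<close>

definition taylor_coeff :: "(complex \<Rightarrow> complex) \<Rightarrow> nat \<Rightarrow> complex" where
  "taylor_coeff f k = (deriv ^^ k) f 0 / fact k"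

lemma taylor_coeff_circle_sums:
  assumes f: "f holomorphic_on ball 0 \<rho>" and R: "0 \<le> R" "R < \<rho>"
  shows "summable (\<lambda>k. norm (taylor_coeff f k * of_real R ^ k))"
    and "(\<lambda>k. taylor_coeff f k * of_real R ^ k * cis (real k * \<theta>)) sums f (of_real R * cis \<theta>)"
proof -
  \<comment> \<open>Convergence at a radius \<open>S\<close> strictly beyond \<open>R\<close> gives
    absolute convergence at \<open>R\<close>.\<close>
  obtain S where S: "R < S" "S < \<rho>" using R dense by blast
  have "(\<lambda>k. taylor_coeff f k * (of_real S - 0) ^ k) sums f (of_real S)"
    unfolding taylor_coeff_def by (rule holomorphic_power_series[OF f]) (use S R in auto)
  then have "summable (\<lambda>k. taylor_coeff f k * of_real S ^ k)" by (simp add: sums_iff)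
  from powser_insidea[OF this, of "of_real R"]
  show "summable (\<lambda>k. norm (taylor_coeff f k * of_real R ^ k))" using S R by simp
  have "(\<lambda>k. taylor_coeff f k * (of_real R * cis \<theta> - 0) ^ k) sums f (of_real R * cis \<theta>)"
    unfolding taylor_coeff_def by (rule holomorphic_power_series[OF f]) (use R in \<open>auto simp: norm_mult\<close>)
  then show "(\<lambda>k. taylor_coeff f k * of_real R ^ k * cis (real k * \<theta>)) sums f (of_real R * cis \<theta>)"
    by (simp add: power_mult_distrib Complex.DeMoivre mult.assoc)
qed

lemma taylor_coeff_deriv: "taylor_coeff (deriv f) k = of_nat (Suc k) * taylor_coeff f (Suc k)"
proof -
  have "of_nat (Suc k) / fact (Suc k) = (1 / fact k :: complex)"
    by (simp add: divide_simps del: of_nat_Suc)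
  then have "of_nat (Suc k) * x / fact (Suc k) = x / fact k" for x :: complex
    by (metis mult.commute times_divide_eq_right mult.right_neutral)
  then show ?thesis unfolding taylor_coeff_def funpow_Suc_right comp_def times_divide_eq_right by simp
qed

text \<open>Without the usual unimodular normalisation, so that a zero at the origin is no special
  case; constants of modulus 1 are carried separately.\<close>

definition blaschke_factor :: "complex \<Rightarrow> complex \<Rightarrow> complex" where
  "blaschke_factor a z = (z - a) / (1 - cnj a * z)"

definition blaschke :: "complex list \<Rightarrow> complex \<Rightarrow> complex" where
  "blaschke as z = (\<Prod>a\<leftarrow>as. blaschke_factor a z)"

text \<open>The product rule as a recursion, so that estimates of the derivative go by induction
  over the list of zeros.\<close>

fun blaschke_deriv :: "complex list \<Rightarrow> complex \<Rightarrow> complex" where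
  "blaschke_deriv [] z = 0"
| "blaschke_deriv (a # as) z =
     of_real (1 - (norm a)\<^sup>2) / (1 - cnj a * z)\<^sup>2 * blaschke as z + blaschke_factor a z * blaschke_deriv as z"

lemma blaschke_simps [simp]:
  "blaschke [] z = 1" "blaschke (a # as) z = blaschke_factor a z * blaschke as z"
  by (simp_all add: blaschke_def)

section \<open>Bounds on a disc slightly larger than the unit disc\<close>

lemma one_minus_cnj_mult_ge:
  assumes "norm a \<le> 1 - \<epsilon>" "norm z \<le> 1 + \<epsilon> / 2" "0 < \<epsilon>" 
  shows "(1 - norm a) / 2 \<le> 1 - norm a * (1 + \<epsilon>/2)"
    and "(1 - norm a) / 2 \<le> norm (1 - cnj a * z)"
proof -
  \<comment> \<open>As \<open>\<epsilon> \<le> 1 - norm a\<close>, going out to radius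
    \<open>1 + \<epsilon>/2\<close> costs the denominator at most half of
    \<open>1 - norm a\<close>.\<close>
  have "norm a * (\<epsilon>/2) \<le> 1 * (\<epsilon>/2)" by (rule mult_right_mono) (use assms in auto)
  then show *: "(1 - norm a) / 2 \<le> 1 - norm a * (1 + \<epsilon>/2)" unfolding distrib_left using assms by argo
  have "norm (cnj a * z) \<le> norm a * (1 + \<epsilon>/2)"
    by (simp add: norm_mult mult_left_mono assms)
  moreover have "norm (1 - cnj a * z) \<ge> 1 - norm (cnj a * z)"
    by (metis norm_one norm_triangle_ineq2)
  ultimately show "(1 - norm a) / 2 \<le> norm (1 - cnj a * z)" using * by linarith
qed

lemma blaschke_factor_has_derivative:
  assumes "1 - cnj a * z \<noteq> 0"
  shows "(blaschke_factor a has_field_derivative of_real (1 - (norm a)\<^sup>2) / (1 - cnj a * z)\<^sup>2) (at z)"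
proof -
  have "(blaschke_factor a has_field_derivative 
     ((1 - cnj a * z) - (z - a) * (- cnj a)) / ((1 - cnj a * z) * (1 - cnj a * z))) (at z)"
    unfolding blaschke_factor_def [abs_def]
    using assms by (auto intro!: derivative_eq_intros)
  moreover have "(1 - cnj a * z) - (z - a) * (- cnj a) = of_real (1 - (norm a)\<^sup>2)"
    by (simp add: algebra_simps complex_norm_square[of a] flip: of_real_power)
  ultimately show ?thesis unfolding power2_eq_square[of "1 - cnj a * z"] by (simp only:)
qed

lemma blaschke_has_derivative:
  assumes "\<And>a. a \<in> set as \<Longrightarrow> 1 - cnj a * z \<noteq> 0"
  shows "(blaschke as has_field_derivative blaschke_deriv as z) (at z)"
  using assms
proof (induction as)
  case Nil
  then show ?case by (simp add: blaschke_def [abs_def])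
next
  case (Cons a as)
  have "((\<lambda>z. blaschke_factor a z * blaschke as z) has_field_derivative blaschke_deriv (a # as) z) (at z)"
    by (rule DERIV_cong[OF DERIV_mult[OF blaschke_factor_has_derivative Cons.IH]])
       (use Cons.prems in \<open>auto simp: algebra_simps\<close>)
  then show ?case by (simp add: blaschke_def [abs_def])
qed

text \<open>Splitting off the value \<open>- a\<close> at the origin leaves (1 - |a|^2) z / (1 -
  conj(a) z). With r = 1 - |a| the numerator is at most 2r * 3/2 and the denominator at least r/2,
  so the total is at most 1 + 6.\<close>

lemma norm_blaschke_factor_le:
  assumes "norm a \<le> 1 - \<epsilon>" "norm z \<le> 1 + \<epsilon> / 2" "0 < \<epsilon>" 
  shows "norm (blaschke_factor a z) \<le> 7"
proof -
  define r where "r = 1 - norm a"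
  have r: "0 < r" "r \<le> 1" "\<epsilon> \<le> r" using assms by (auto simp: r_def)
  have d: "r / 2 \<le> norm (1 - cnj a * z)" using one_minus_cnj_mult_ge(2)[OF assms] by (simp add: r_def)
  then have nz: "1 - cnj a * z \<noteq> 0" using r by auto
  have "z - a = - a * (1 - cnj a * z) + of_real (1 - (norm a)\<^sup>2) * z"
    by (simp add: algebra_simps complex_norm_square[of a] flip: of_real_power)
  then have "blaschke_factor a z = - a + of_real (1 - (norm a)\<^sup>2) * z / (1 - cnj a * z)"
    unfolding blaschke_factor_def using nz by (simp only: add_divide_distrib) simp
  then have "norm (blaschke_factor a z) \<le> norm a + norm (of_real (1 - (norm a)\<^sup>2) * z / (1 - cnj a * z))"
    by (metis norm_minus_cancel norm_triangle_ineq)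
  also have "norm (of_real (1 - (norm a)\<^sup>2) * z / (1 - cnj a * z)) \<le> (2 * r * (3/2)) / (r / 2)"
  proof -
    have "1 - (norm a)\<^sup>2 = r * (1 + norm a)" by (simp add: r_def power2_eq_square algebra_simps)
    moreover have "r * (1 + norm a) \<le> r * 2"
      by (rule mult_left_mono) (use r assms in auto)
    moreover have "0 \<le> r * (1 + norm a)" using r by simp
    ultimately have "norm (of_real (1 - (norm a)\<^sup>2) :: complex) \<le> 2 * r"
      by (simp only: norm_of_real abs_of_nonneg mult.commute)
    moreover have "norm z \<le> 3/2" using assms r by linarith
    ultimately have "norm (of_real (1 - (norm a)\<^sup>2) * z) \<le> 2 * r * (3/2)"
      unfolding norm_mult using r by (intro mult_mono) auto
    then show ?thesis unfolding norm_divide using d r by (intro frac_le) auto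
  qed
  also have "\<dots> = 6" using r by simp
  finally show ?thesis using r by (simp add: r_def)
qed

lemma norm_blaschke_le:
  assumes "\<And>a. a \<in> set as \<Longrightarrow> norm a \<le> 1 - \<epsilon>" "norm z \<le> 1 + \<epsilon> / 2" "0 < \<epsilon>"
  shows "norm (blaschke as z) \<le> 7 ^ length as"
  using assms(1)
proof (induction as)
  case (Cons a as)
  show ?case using norm_blaschke_factor_le[OF _ assms(2,3), of a] Cons
    by (auto simp: norm_mult intro!: mult_mono)
qed simp

text \<open>Product rule with every undifferentiated factor bounded by 7. The summands are the
  moduli of the derivatives of the single factors; on the unit circle they are the Poisson kernels
  of the zeros.\<close>

lemma norm_blaschke_deriv_le:
  assumes "\<And>a. a \<in> set as \<Longrightarrow> norm a \<le> 1 - \<epsilon>" "norm z \<le> 1 + \<epsilon> / 2" "0 < \<epsilon>"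
  shows "norm (blaschke_deriv as z) \<le> 7 ^ length as * (\<Sum>a\<leftarrow>as. (1 - (norm a)\<^sup>2) / (norm (1 - cnj a * z))\<^sup>2)"
  using assms(1)
proof (induction as)
  case (Cons a as)
  define x where "x = (1 - (norm a)\<^sup>2) / (norm (1 - cnj a * z))\<^sup>2"
  define S where "S = (\<Sum>a\<leftarrow>as. (1 - (norm a)\<^sup>2) / (norm (1 - cnj a * z))\<^sup>2)"
  have "norm a \<le> 1" using Cons.prems[of a] assms(3) by simp
  then have a: "(norm a)\<^sup>2 \<le> 1" by (simp add: power_le_one)
  then have x: "0 \<le> x" by (simp add: x_def)
  have nx: "norm (of_real (1 - (norm a)\<^sup>2) / (1 - cnj a * z)\<^sup>2) = x"
    using a by (simp add: x_def norm_divide norm_power del: of_real_diff)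
  have "norm (blaschke_deriv (a # as) z) \<le> x * norm (blaschke as z) + norm (blaschke_factor a z) * norm (blaschke_deriv as z)"
    using norm_triangle_ineq[of "of_real (1 - (norm a)\<^sup>2) / (1 - cnj a * z)\<^sup>2 * blaschke as z" "blaschke_factor a z * blaschke_deriv as z"]
    by (simp only: blaschke_deriv.simps norm_mult nx)
  also have "\<dots> \<le> x * 7 ^ length as + 7 * (7 ^ length as * S)"
    using Cons.IH Cons.prems x norm_blaschke_le[OF _ assms(2,3), of as] norm_blaschke_factor_le[OF _ assms(2,3), of a]
    by (intro add_mono mult_mono) (auto simp: S_def)
  also have "\<dots> \<le> 7 ^ length (a # as) * (x + S)" using x by (simp add: algebra_simps)
  finally show ?case by (simp add: x_def S_def)
qed simp

text \<open>Parseval for the geometric series of 1 / (1 - w e^(i \<theta>)).\<close>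

lemma circle_integral_inverse_square:
  assumes "norm w < 1"
  shows "((\<lambda>\<theta>. 1 / (norm (1 - w * cis \<theta>))\<^sup>2) has_integral 2 * pi / (1 - (norm w)\<^sup>2)) {0..2*pi}"
proof -
  have nw: "(norm w)\<^sup>2 < 1" using assms by (simp add: power_less_one_iff)
  have nz: "1 - w * cis \<theta> \<noteq> 0" for \<theta>
  proof
    assume "1 - w * cis \<theta> = 0"
    then have "norm (w * cis \<theta>) = 1" by simp
    then show False using assms by (simp add: norm_mult)
  qed
  have sm: "summable (\<lambda>k. norm (w ^ k))" using assms by (simp add: norm_power summable_geometric)
  have gs: "(\<lambda>k. w ^ k * cis (real k * \<theta>)) sums (1 / (1 - w * cis \<theta>))" for \<theta>
    using geometric_sums[of "w * cis \<theta>"] assms by (simp add: norm_mult power_mult_distrib Complex.DeMoivre)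
  have "(\<lambda>k. 2 * pi * (w ^ k * cnj (w ^ k))) sums
      integral {0..2*pi} (\<lambda>\<theta>. 1 / (1 - w * cis \<theta>) * cnj (1 / (1 - w * cis \<theta>)))"
    by (rule parseval_sums[OF sm sm gs gs])
  moreover have "(\<lambda>k. 2 * pi * (w ^ k * cnj (w ^ k))) sums (of_real (2 * pi) * of_real (1 / (1 - (norm w)\<^sup>2)))"
  proof -
    have "(\<lambda>k. of_real (((norm w)\<^sup>2) ^ k) :: complex) sums of_real (1 / (1 - (norm w)\<^sup>2))"
      unfolding sums_of_real_iff by (rule geometric_sums) (use nw in simp)
    moreover have "w ^ k * cnj (w ^ k) = of_real (((norm w)\<^sup>2) ^ k)" for k
      by (subst of_real_power) (simp only: complex_norm_square power_mult_distrib complex_cnj_power)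
    ultimately show ?thesis by (simp only:) (rule sums_mult)
  qed
  moreover have "1 / (1 - w * cis \<theta>) * cnj (1 / (1 - w * cis \<theta>)) = of_real (1 / (norm (1 - w * cis \<theta>))\<^sup>2)" for \<theta>
    unfolding complex_norm_square[symmetric] by (simp add: norm_divide power_divide)
  ultimately have "integral {0..2*pi} (\<lambda>\<theta>. complex_of_real (1 / (norm (1 - w * cis \<theta>))\<^sup>2)) =
      of_real (2 * pi) * of_real (1 / (1 - (norm w)\<^sup>2))"
    by (simp only: sums_unique2)
  moreover have int: "(\<lambda>\<theta>. 1 / (norm (1 - w * cis \<theta>))\<^sup>2) integrable_on {0..2*pi}"
    using nz by (intro integrable_continuous_interval continuous_intros) auto
  then have "((\<lambda>\<theta>. complex_of_real (1 / (norm (1 - w * cis \<theta>))\<^sup>2)) has_integral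
      of_real (integral {0..2*pi} (\<lambda>\<theta>. 1 / (norm (1 - w * cis \<theta>))\<^sup>2))) {0..2*pi}"
    by (intro has_integral_of_real integrable_integral)
  ultimately have "of_real (integral {0..2*pi} (\<lambda>\<theta>. 1 / (norm (1 - w * cis \<theta>))\<^sup>2)) =
      complex_of_real (2 * pi * (1 / (1 - (norm w)\<^sup>2)))"
    by (simp only: integral_unique of_real_mult)
  then have "integral {0..2*pi} (\<lambda>\<theta>. 1 / (norm (1 - w * cis \<theta>))\<^sup>2) = 2 * pi * (1 / (1 - (norm w)\<^sup>2))"
    by (simp only: of_real_eq_iff)
  with int show ?thesis by (simp add: has_integral_iff)
qed

lemma blaschke_holomorphic:
  assumes as: "\<And>a. a \<in> set as \<Longrightarrow> norm a \<le> 1 - \<epsilon>" and e: "0 < \<epsilon>" "\<epsilon> \<le> 1"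
  shows "blaschke as holomorphic_on ball 0 (1 + \<epsilon>)"
proof -
  have "1 - cnj a * z \<noteq> 0" if "a \<in> set as" "norm z < 1 + \<epsilon>" for a z
  proof
    assume "1 - cnj a * z = 0"
    then have "1 = norm a * norm z" by (metis complex_mod_cnj eq_iff_diff_eq_0 norm_mult norm_one)
    also have "\<dots> \<le> (1 - \<epsilon>) * (1 + \<epsilon>)" using as[OF that(1)] that(2) e by (intro mult_mono) auto
    also have "\<dots> = 1 - \<epsilon> * \<epsilon>" by (simp add: algebra_simps)
    finally show False using mult_pos_pos[OF e(1) e(1)] by linarith
  qed
  then show ?thesis
    unfolding holomorphic_on_open[OF open_ball] using blaschke_has_derivative by (metis mem_ball_0)
qed

text \<open>The bound does not degenerate as \<open>a\<close> approaches the circle. With w =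
  conj(a) R the integral is 2 pi (1 - |a|^2) / (1 - |w|^2), and 1 - |a|^2 \<le> 2 (1 - |a|) \<le> 4
  (1 - |w|) \<le> 4 (1 - |w|^2).\<close>

lemma circle_integral_blaschke_factor_deriv_le:
  assumes a: "norm a \<le> 1 - \<epsilon>" and e: "0 < \<epsilon>" "\<epsilon> \<le> 1"
  shows "(\<lambda>\<theta>. (1 - (norm a)\<^sup>2) / (norm (1 - cnj a * (of_real (1 + \<epsilon>/2) * cis \<theta>)))\<^sup>2) integrable_on {0..2*pi}"
    and "integral {0..2*pi} (\<lambda>\<theta>. (1 - (norm a)\<^sup>2) / (norm (1 - cnj a * (of_real (1 + \<epsilon>/2) * cis \<theta>)))\<^sup>2) \<le> 8 * pi"
proof -
  define R where "R = 1 + \<epsilon>/2"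
  define w where "w = cnj a * of_real R"
  have "0 < R" using e by (simp add: R_def)
  then have nw: "norm w = norm a * R" by (simp add: w_def norm_mult)
  have 1: "(1 - norm a) / 2 \<le> 1 - norm w"
    unfolding nw R_def using one_minus_cnj_mult_ge(1)[OF a _ e(1), of 0] e by simp
  have a1: "norm a < 1" using a e by simp
  have w1: "norm w < 1" using 1 a1 by argo
  have w2: "1 - norm w \<le> 1 - (norm w)\<^sup>2"
    using w1 by (simp add: power2_eq_square mult_left_le_one_le)
  have "((\<lambda>\<theta>. (1 - (norm a)\<^sup>2) * (1 / (norm (1 - w * cis \<theta>))\<^sup>2)) has_integral (1 - (norm a)\<^sup>2) * (2 * pi / (1 - (norm w)\<^sup>2))) {0..2*pi}"
    by (intro has_integral_mult_right circle_integral_inverse_square w1)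
  then have *: "((\<lambda>\<theta>. (1 - (norm a)\<^sup>2) / (norm (1 - cnj a * (of_real R * cis \<theta>)))\<^sup>2) has_integral (1 - (norm a)\<^sup>2) * (2 * pi / (1 - (norm w)\<^sup>2))) {0..2*pi}"
    by (simp add: w_def mult.assoc)
  have "1 - (norm a)\<^sup>2 = (1 - norm a) * (1 + norm a)" by (simp add: power2_eq_square algebra_simps)
  also have "\<dots> \<le> (1 - norm a) * 2" using a1 by (intro mult_left_mono) auto
  also have "\<dots> \<le> 4 * (1 - (norm w)\<^sup>2)" using 1 w2 by argo
  finally have "(1 - (norm a)\<^sup>2) * (2 * pi) \<le> (4 * (1 - (norm w)\<^sup>2)) * (2 * pi)"
    by (rule mult_right_mono) simp
  then have "(1 - (norm a)\<^sup>2) * (2 * pi / (1 - (norm w)\<^sup>2)) \<le> 8 * pi"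
    using w2 w1 by (simp add: divide_simps mult_ac)
  with * show "(\<lambda>\<theta>. (1 - (norm a)\<^sup>2) / (norm (1 - cnj a * (of_real (1 + \<epsilon>/2) * cis \<theta>)))\<^sup>2) integrable_on {0..2*pi}"
    and "integral {0..2*pi} (\<lambda>\<theta>. (1 - (norm a)\<^sup>2) / (norm (1 - cnj a * (of_real (1 + \<epsilon>/2) * cis \<theta>)))\<^sup>2) \<le> 8 * pi"
    by (auto simp: has_integral_iff R_def)
qed

lemma has_integral_sum_list:
  fixes f :: "'b \<Rightarrow> 'n::euclidean_space \<Rightarrow> 'c::real_normed_vector"
  assumes "\<And>a. a \<in> set as \<Longrightarrow> (f a has_integral I a) S"
  shows "((\<lambda>x. \<Sum>a\<leftarrow>as. f a x) has_integral (\<Sum>a\<leftarrow>as. I a)) S"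
  using assms by (induction as) (auto intro: has_integral_add)

text \<open>An integrable majorant \<open>g\<close> is handed on in place of the norm itself, ready
  for the comparison of integrals in the energy estimate.\<close>

lemma integral_norm_blaschke_deriv_le:
  assumes as: "\<And>a. a \<in> set as \<Longrightarrow> norm a \<le> 1 - \<epsilon>" and e: "0 < \<epsilon>" "\<epsilon> \<le> 1"
  shows "\<exists>g I. (\<forall>\<theta>. norm (blaschke_deriv as (of_real (1 + \<epsilon>/2) * cis \<theta>)) \<le> g \<theta>) \<and> (g has_integral I) {0..2*pi} \<and>
    I \<le> 7 ^ length as * (real (length as) * (8 * pi))"
proof -
  define h where "h = (\<lambda>a \<theta>. (1 - (norm a)\<^sup>2) / (norm (1 - cnj a * (of_real (1 + \<epsilon>/2) * cis \<theta>)))\<^sup>2)"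
  define g where "g = (\<lambda>\<theta>. 7 ^ length as * (\<Sum>a\<leftarrow>as. h a \<theta>))"
  have "norm (blaschke_deriv as (of_real (1 + \<epsilon>/2) * cis \<theta>)) \<le> g \<theta>" for \<theta>
    unfolding g_def h_def by (rule norm_blaschke_deriv_le[OF as]) (use e in \<open>auto simp: norm_mult simp del: of_real_add\<close>)
  moreover have "(g has_integral 7 ^ length as * (\<Sum>a\<leftarrow>as. integral {0..2*pi} (h a))) {0..2*pi}"
    unfolding g_def
    by (intro has_integral_mult_right has_integral_sum_list integrable_integral)
       (use circle_integral_blaschke_factor_deriv_le(1)[OF as e] in \<open>auto simp: h_def\<close>)
  moreover have "(\<Sum>a\<leftarrow>as. integral {0..2*pi} (h a)) \<le> (\<Sum>a\<leftarrow>as. 8 * pi)"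
    by (rule sum_list_mono) (use circle_integral_blaschke_factor_deriv_le(2)[OF as e] in \<open>auto simp: h_def\<close>)
  then have "7 ^ length as * (\<Sum>a\<leftarrow>as. integral {0..2*pi} (h a)) \<le> 7 ^ length as * (real (length as) * (8 * pi))"
    by (intro mult_left_mono) (simp_all add: sum_list_triv)
  ultimately show ?thesis by blast
qed

text \<open>The left-hand side is the area, counted with multiplicity and divided by \<open>pi\<close>, of the image
  of a disc slightly larger than the unit disc.\<close>
lemma blaschke_dirichlet_energy_le:
  assumes as: "\<And>a. a \<in> set as \<Longrightarrow> norm a \<le> 1 - \<epsilon>" and e: "0 < \<epsilon>" "\<epsilon> \<le> 1"
  shows "(\<Sum>k<K. real k * (norm (taylor_coeff (blaschke as) k))\<^sup>2 * (1 + \<epsilon>/2) ^ (2 * k)) \<le> 6 * real (length as) * 49 ^ length as"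
proof -
  define R where "R = 1 + \<epsilon>/2"
  define b where "b = taylor_coeff (blaschke as)"
  have R: "0 \<le> R" "R < 1 + \<epsilon>" "R \<le> 3/2" "0 < R" using e by (auto simp: R_def)
  have hol: "blaschke as holomorphic_on ball 0 (1 + \<epsilon>)" by (rule blaschke_holomorphic[OF as e])
  have hold: "deriv (blaschke as) holomorphic_on ball 0 (1 + \<epsilon>)" by (rule holomorphic_deriv[OF hol open_ball])
  have dB: "deriv (blaschke as) z = blaschke_deriv as z" if "norm z \<le> R" for z
  proof (rule DERIV_imp_deriv[OF blaschke_has_derivative])
    fix a assume a: "a \<in> set as"
    have "(1 - norm a) / 2 \<le> norm (1 - cnj a * z)"
      by (rule one_minus_cnj_mult_ge(2)[OF as[OF a] _ e(1)]) (use that in \<open>simp add: R_def\<close>)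
    then show "1 - cnj a * z \<noteq> 0" using as[OF a] e by auto
  qed
  \<comment> \<open>On the circle of radius \<open>R\<close>, \<open>x\<close> holds the
    coefficients of z B' and \<open>y\<close> those of B. Multiplying B' by z aligns the indices:
    \<open>x k\<close> is \<open>k\<close> times \<open>y k\<close>, and
    \<open>x 0 = 0\<close>.\<close>
  define x where "x = (\<lambda>k. of_nat k * b k * of_real R ^ k)"
  define y where "y = (\<lambda>k. b k * of_real R ^ k)"
  define X where "X = (\<lambda>\<theta>. of_real R * cis \<theta> * blaschke_deriv as (of_real R * cis \<theta>))"
  define Y where "Y = (\<lambda>\<theta>. blaschke as (of_real R * cis \<theta>))"
  have x_Suc: "x (Suc k) = of_real R * (taylor_coeff (deriv (blaschke as)) k * of_real R ^ k)" for k
    unfolding x_def taylor_coeff_deriv b_def by (simp del: of_nat_Suc)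
  have sx: "summable (\<lambda>k. norm (x k))"
    unfolding summable_Suc_iff[of "\<lambda>k. norm (x k)", symmetric] x_Suc norm_mult[of "of_real R"]
    by (rule summable_mult[OF taylor_coeff_circle_sums(1)[OF hold R(1,2)]])
  have X: "(\<lambda>k. x k * cis (real k * \<theta>)) sums X \<theta>" for \<theta>
  proof -
    have "(\<lambda>k. of_real R * cis \<theta> * (taylor_coeff (deriv (blaschke as)) k * of_real R ^ k * cis (real k * \<theta>))) sums
      (of_real R * cis \<theta> * deriv (blaschke as) (of_real R * cis \<theta>))"
      by (rule sums_mult[OF taylor_coeff_circle_sums(2)[OF hold R(1,2)]])
    moreover have "of_real R * cis \<theta> * (taylor_coeff (deriv (blaschke as)) k * of_real R ^ k * cis (real k * \<theta>)) =
        x (Suc k) * cis (real (Suc k) * \<theta>)" for k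
    proof -
      have "cis (real (Suc k) * \<theta>) = cis \<theta> * cis (real k * \<theta>)"
        by (simp add: cis_mult algebra_simps)
      then show ?thesis unfolding x_Suc by (simp only: mult_ac)
    qed
    moreover have "deriv (blaschke as) (of_real R * cis \<theta>) = blaschke_deriv as (of_real R * cis \<theta>)"
      by (rule dB) (use R in \<open>simp add: norm_mult\<close>)
    ultimately have "(\<lambda>k. x (Suc k) * cis (real (Suc k) * \<theta>)) sums X \<theta>" by (simp add: X_def)
    then show ?thesis by (subst (asm) sums_Suc_iff) (simp add: x_def)
  qed
  have sy: "summable (\<lambda>k. norm (y k))"
    unfolding y_def b_def by (rule taylor_coeff_circle_sums(1)[OF hol R(1,2)])
  have Y: "(\<lambda>k. y k * cis (real k * \<theta>)) sums Y \<theta>" for \<theta>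
    unfolding y_def Y_def b_def by (rule taylor_coeff_circle_sums(2)[OF hol R(1,2)])
  have xy: "2 * pi * (x k * cnj (y k)) = of_real (2 * pi * (real k * (norm (b k))\<^sup>2 * R ^ (2 * k)))" for k
  proof -
    have "x k * cnj (y k) = of_nat k * (b k * cnj (b k)) * (of_real R ^ k * of_real R ^ k)"
      by (simp add: x_def y_def mult_ac)
    also have "\<dots> = of_real (real k * (norm (b k))\<^sup>2 * R ^ (2 * k))"
      unfolding of_real_mult complex_norm_square by (simp add: mult_2 power_add)
    finally show ?thesis by simp
  qed
  define J where "J = integral {0..2*pi} (\<lambda>\<theta>. X \<theta> * cnj (Y \<theta>))"
  have "(\<lambda>k. complex_of_real (2 * pi * (real k * (norm (b k))\<^sup>2 * R ^ (2 * k)))) sums J"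
    unfolding J_def using parseval_sums[OF sx sy X Y] by (simp only: xy)
  then have Re: "(\<lambda>k. 2 * pi * (real k * (norm (b k))\<^sup>2 * R ^ (2 * k))) sums Re J"
    by (drule_tac sums_Re) simp
  have "(\<Sum>k<K. 2 * pi * (real k * (norm (b k))\<^sup>2 * R ^ (2 * k))) \<le> Re J"
    by (rule sum_le_suminf[OF sums_summable[OF Re], unfolded sums_unique[OF Re, symmetric]]) (use R in auto)
  also have "\<dots> \<le> norm J" by (rule complex_Re_le_cmod)
  also have "norm J \<le> R * 7 ^ length as * (7 ^ length as * (real (length as) * (8 * pi)))"
  proof -
    obtain g I where g: "\<And>\<theta>. norm (blaschke_deriv as (of_real R * cis \<theta>)) \<le> g \<theta>"
      "(g has_integral I) {0..2*pi}" "I \<le> 7 ^ length as * (real (length as) * (8 * pi))"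
      using integral_norm_blaschke_deriv_le[OF as e] unfolding R_def[symmetric] by blast
    have "norm J \<le> R * 7 ^ length as * I"
      unfolding J_def
    proof (rule integral_norm_bound_integral[THEN order_trans])
      have "continuous_on UNIV X" "continuous_on UNIV Y"
        by (rule fourier_series_integral_sums(2)[OF sx X, of "\<lambda>_. 0"], simp)
           (rule fourier_series_integral_sums(2)[OF sy Y, of "\<lambda>_. 0"], simp)
      then show "(\<lambda>\<theta>. X \<theta> * cnj (Y \<theta>)) integrable_on {0..2*pi}"
        by (intro integrable_continuous_interval continuous_intros) (auto intro: continuous_on_subset)
      have gI: "((\<lambda>\<theta>. R * 7 ^ length as * g \<theta>) has_integral R * 7 ^ length as * I) {0..2*pi}"
        by (rule has_integral_mult_right[OF g(2)])
      then show "(\<lambda>\<theta>. R * 7 ^ length as * g \<theta>) integrable_on {0..2*pi}" by blast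
      show "integral {0..2*pi} (\<lambda>\<theta>. R * 7 ^ length as * g \<theta>) \<le> R * 7 ^ length as * I"
        using integral_unique[OF gI] by (rule eq_refl)
      fix \<theta> :: real
      have "norm (Y \<theta>) \<le> 7 ^ length as"
        unfolding Y_def by (rule norm_blaschke_le[OF as _ e(1)]) (use R in \<open>auto simp: norm_mult R_def simp del: of_real_add\<close>)
      moreover have "norm (X \<theta>) \<le> R * g \<theta>"
        using g(1)[of \<theta>] R by (simp add: X_def norm_mult mult_left_mono)
      ultimately have "norm (X \<theta>) * norm (Y \<theta>) \<le> (R * g \<theta>) * 7 ^ length as"
        using order_trans[OF norm_ge_zero g(1)] R by (intro mult_mono) (auto intro!: mult_nonneg_nonneg)
      then show "norm (X \<theta> * cnj (Y \<theta>)) \<le> R * 7 ^ length as * g \<theta>" by (simp add: norm_mult mult_ac)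
    qed
    also have "\<dots> \<le> R * 7 ^ length as * (7 ^ length as * (real (length as) * (8 * pi)))"
      using g(3) R by (intro mult_left_mono) auto
    finally show ?thesis .
  qed
  \<comment> \<open>The 6 of the statement arises here: 3/2 * 8 pi = 2 pi * 6.\<close>
  also have "\<dots> \<le> (3/2) * 7 ^ length as * (7 ^ length as * (real (length as) * (8 * pi)))"
    using R by (intro mult_right_mono) auto
  also have "\<dots> = 2 * pi * (6 * real (length as) * 49 ^ length as)"
    by (simp flip: power_mult_distrib)
  finally show ?thesis
    by (simp add: b_def R_def flip: sum_distrib_left)
qed

text \<open>Put x = k \<epsilon> and a = P - 1, so that k^P = k \<epsilon>^(1-P) x^a. Raising t
  \<le> e^t at t = x / (4a) to the power a gives x^a \<le> (4a)^a e^(x/4). The exponential is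
  absorbed because ln (1 + \<epsilon>/2) \<ge> \<epsilon>/4 for \<epsilon> \<le> 1.\<close>

lemma powr_le_geometric_growth:
  assumes P: "1 < P" and e: "0 < \<epsilon>" "\<epsilon> \<le> 1"
  shows "real k powr P \<le> (4 * (P - 1)) powr (P - 1) * \<epsilon> powr (1 - P) * (real k * (1 + \<epsilon>/2) ^ (2 * k))"
proof (cases "k = 0")
  case False
  define a where "a = P - 1"
  have a: "a > 0" using P by (simp add: a_def)
  define x where "x = real k * \<epsilon>"
  have x: "x > 0" using False e by (simp add: x_def)
  have "x powr a = (4 * a) powr a * (x / (4 * a)) powr a"
    using a x by (simp flip: powr_mult)
  also have "(x / (4 * a)) powr a \<le> (exp (x / (4 * a))) powr a"
  proof (rule powr_mono2)
    show "x / (4 * a) \<le> exp (x / (4 * a))" by (rule order_trans[OF _ exp_ge_add_one_self]) simp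
  qed (use a x in auto)
  also have "(exp (x / (4 * a))) powr a = exp (x / 4)"
    using a by (simp add: exp_powr_real)
  also have "exp (x / 4) \<le> exp (real (2 * k) * ln (1 + \<epsilon>/2))"
  proof -
    have "\<epsilon>/2 - (\<epsilon>/2)\<^sup>2 \<le> ln (1 + \<epsilon>/2)" by (rule ln_one_plus_pos_lower_bound) (use e in auto)
    moreover have "(\<epsilon>/2)\<^sup>2 \<le> (\<epsilon>/2) * (1/2)" unfolding power2_eq_square by (rule mult_left_mono) (use e in auto)
    ultimately have "\<epsilon> / 4 \<le> ln (1 + \<epsilon>/2)" by argo
    then have "real (2 * k) * (\<epsilon> / 4) \<le> real (2 * k) * ln (1 + \<epsilon>/2)" by (rule mult_left_mono) simp
    moreover have "x / 4 \<le> real (2 * k) * (\<epsilon> / 4)" using e by (simp add: x_def)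
    ultimately show ?thesis by simp
  qed
  also have "exp (real (2 * k) * ln (1 + \<epsilon>/2)) = (1 + \<epsilon>/2) ^ (2 * k)"
    using e by (simp only: exp_of_nat_mult) simp
  finally have *: "x powr a \<le> (4 * a) powr a * (1 + \<epsilon>/2) ^ (2 * k)" by (simp add: mult_left_mono)
  have "real k powr P = real k * real k powr a" using False by (simp add: a_def powr_diff)
  also have "real k powr a = \<epsilon> powr (1 - P) * x powr a"
    using e by (simp add: x_def a_def powr_mult powr_diff)
  also have "real k * (\<epsilon> powr (1 - P) * x powr a) \<le> real k * (\<epsilon> powr (1 - P) * ((4 * a) powr a * (1 + \<epsilon>/2) ^ (2 * k)))"
    using * by (intro mult_left_mono) auto
  finally show ?thesis by (simp add: a_def mult_ac)
qed simp

section \<open>The derivative on the unit circle\<close>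

lemma blaschke_on_circle:
  assumes as: "\<And>a. a \<in> set as \<Longrightarrow> norm a < 1" and z: "norm z = 1"
  shows "norm (blaschke as z) = 1"
    and "z * blaschke_deriv as z = blaschke as z * of_real (\<Sum>a\<leftarrow>as. (1 - (norm a)\<^sup>2) / (norm (1 - cnj a * z))\<^sup>2)"
proof -
  have zz: "z * cnj z = 1" using z by (simp flip: complex_norm_square)
  have f: "norm (blaschke_factor a z) = 1"
     "z * (of_real (1 - (norm a)\<^sup>2) / (1 - cnj a * z)\<^sup>2) = blaschke_factor a z * of_real ((1 - (norm a)\<^sup>2) / (norm (1 - cnj a * z))\<^sup>2)"
    if "norm a < 1" for a
  proof -
    define D where "D = 1 - cnj a * z"
    have D: "D \<noteq> 0"
    proof
      assume "D = 0"
      then have "norm (cnj a * z) = 1" by (simp add: D_def)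
      then show False using that z by (simp add: norm_mult)
    qed
    \<comment> \<open>For |z| = 1 numerator and denominator of the factor are conjugate up to z.
      Hence the factor is unimodular, and z times its logarithmic derivative is real and
      positive.\<close>
    have zD: "z - a = z * cnj D" using zz by (simp add: D_def algebra_simps)
    have "norm (z - a) = norm D" unfolding zD using z by (simp add: norm_mult)
    then show "norm (blaschke_factor a z) = 1" using D by (simp add: blaschke_factor_def norm_divide D_def)
    have "(z - a) / D * (c / (D * cnj D)) = z * (c / D\<^sup>2)" for c
      unfolding zD using D by (simp add: power2_eq_square)
    then show "z * (of_real (1 - (norm a)\<^sup>2) / (1 - cnj a * z)\<^sup>2) = blaschke_factor a z * of_real ((1 - (norm a)\<^sup>2) / (norm (1 - cnj a * z))\<^sup>2)"
      unfolding of_real_divide blaschke_factor_def D_def[symmetric] complex_norm_square[of D] by (simp only:)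
  qed
  show "norm (blaschke as z) = 1"
    using as by (induction as) (auto simp: norm_mult f(1))
  show "z * blaschke_deriv as z = blaschke as z * of_real (\<Sum>a\<leftarrow>as. (1 - (norm a)\<^sup>2) / (norm (1 - cnj a * z))\<^sup>2)"
    using as
  proof (induction as)
    case (Cons a as)
    have "z * blaschke_deriv (a # as) z = z * (of_real (1 - (norm a)\<^sup>2) / (1 - cnj a * z)\<^sup>2) * blaschke as z
        + blaschke_factor a z * (z * blaschke_deriv as z)"
      by (simp add: algebra_simps)
    also have "z * blaschke_deriv as z = blaschke as z * of_real (\<Sum>a\<leftarrow>as. (1 - (norm a)\<^sup>2) / (norm (1 - cnj a * z))\<^sup>2)"
      using Cons by simp
    also have "z * (of_real (1 - (norm a)\<^sup>2) / (1 - cnj a * z)\<^sup>2) = blaschke_factor a z * of_real ((1 - (norm a)\<^sup>2) / (norm (1 - cnj a * z))\<^sup>2)"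
      using Cons.prems by (intro f(2)) simp
    finally show ?case by (simp only: list.map sum_list.Cons of_real_add blaschke_simps distrib_left mult_ac)
  qed simp
qed

text \<open>On the circle z B' / B is a sum of positive terms, so |B'| dominates each of them; the
  other zeros cannot spoil the contribution of \<open>a\<close>.\<close>

lemma norm_blaschke_deriv_circle_ge:
  assumes as: "\<And>a. a \<in> set as \<Longrightarrow> norm a < 1" and z: "norm z = 1" and a: "a \<in> set as"
  shows "(1 - (norm a)\<^sup>2) / (norm (1 - cnj a * z))\<^sup>2 \<le> norm (blaschke_deriv as z)"
proof -
  define h where "h = (\<lambda>a. (1 - (norm a)\<^sup>2) / (norm (1 - cnj a * z))\<^sup>2)"
  have nn: "0 \<le> h b" if "b \<in> set as" for b
    unfolding h_def using as[OF that] by (simp add: power_le_one)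
  have "h a \<le> (\<Sum>a\<leftarrow>as. h a)" using a nn
    by (intro member_le_sum_list) auto
  moreover have "norm (z * blaschke_deriv as z) = norm (blaschke as z) * \<bar>\<Sum>a\<leftarrow>as. h a\<bar>"
    unfolding h_def by (subst blaschke_on_circle(2)[OF as z]) (simp_all only: norm_mult norm_of_real)
  then have "norm (blaschke_deriv as z) = \<bar>\<Sum>a\<leftarrow>as. h a\<bar>"
    using blaschke_on_circle(1)[OF as z] z by (simp add: norm_mult)
  ultimately show ?thesis by (simp add: h_def)
qed

lemma norm_one_minus_cis_le: "norm (1 - cis x) \<le> \<bar>x\<bar>"
proof -
  have "norm (1 - cis x) = 2 * \<bar>sin (x / 2)\<bar>"
    by (metis cis_conv_exp dist_exp_i_1 norm_minus_commute)
  also have "\<dots> \<le> 2 * \<bar>x / 2\<bar>" using abs_sin_x_le_abs_x[of "x/2"] by simp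
  finally show ?thesis by simp
qed

text \<open>With \<open>\<epsilon> = 1 - norm a\<close>, on an arc of length
  \<open>\<epsilon>\<close> next to the angle of \<open>a\<close> the denominator is at most 2
  \<epsilon>, so |B'| \<ge> \<epsilon> / (2 \<epsilon>)^2 = 1 / (4 \<epsilon>). Integrating the
  power P over the arc gives 4^(-P) \<epsilon>^(1-P). The majorant \<open>g\<close> is only compared
  almost everywhere, since slices may be undefined at finitely many points of the circle.\<close>

lemma blaschke_circle_integral_ge:
  assumes as: "\<And>b. b \<in> set as \<Longrightarrow> norm b < 1" and a: "a \<in> set as" and P: "0 < P"
    and g: "AE s in lborel. s \<in> {0..2*pi} \<longrightarrow> ennreal (norm (blaschke_deriv as (cis s)) powr P) \<le> g s"
  shows "ennreal ((1 - norm a) powr (1 - P)) \<le> ennreal (4 powr P) * (\<integral>\<^sup>+s\<in>{0..2*pi}. g s \<partial>lborel)"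
proof -
  define \<epsilon> where "\<epsilon> = 1 - norm a"
  have e: "0 < \<epsilon>" "\<epsilon> \<le> 1" using as[OF a] by (auto simp: \<epsilon>_def)
  define \<theta> where "\<theta> = Arg2pi a"
  have th: "0 \<le> \<theta>" "\<theta> < 2 * pi" by (auto simp: \<theta>_def Arg2pi)
  have a_eq: "a = of_real (norm a) * cis \<theta>"
    unfolding \<theta>_def cis_conv_exp using Arg2pi_eq[of a] by simp
  \<comment> \<open>The arc starts or ends at \<open>\<theta>\<close>, on the side that keeps it
    inside \<open>{0..2*pi}\<close>; this works since
    \<open>\<epsilon> \<le> 1 < pi\<close>.\<close>
  define u where "u = (if \<theta> \<le> pi then \<theta> else \<theta> - \<epsilon>)"
  have J: "{u..u+\<epsilon>} \<subseteq> {0..2*pi}" and J': "\<And>s. s \<in> {u..u+\<epsilon>} \<Longrightarrow> \<bar>s - \<theta>\<bar> \<le> \<epsilon>"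
    using e th pi_gt3 by (auto simp: u_def split: if_splits)
  have bound: "1 / (4 * \<epsilon>) \<le> norm (blaschke_deriv as (cis s))" if s: "s \<in> {u..u+\<epsilon>}" for s
  proof -
    have "cnj a * cis s = of_real (norm a) * cis (s - \<theta>)"
      by (subst a_eq) (simp add: cis_cnj cis_mult)
    then have "1 - cnj a * cis s = of_real \<epsilon> + of_real (norm a) * (1 - cis (s - \<theta>))"
      by (simp add: \<epsilon>_def algebra_simps)
    also have "norm \<dots> \<le> \<epsilon> + norm a * norm (1 - cis (s - \<theta>))"
      using e by (intro norm_triangle_le add_mono) (auto simp: norm_mult)
    also have "norm a * norm (1 - cis (s - \<theta>)) \<le> 1 * \<epsilon>"
      using norm_one_minus_cis_le[of "s - \<theta>"] J'[OF s] as[OF a] by (intro mult_mono) auto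
    finally have n: "norm (1 - cnj a * cis s) \<le> 2 * \<epsilon>" by simp
    have n0: "norm (1 - cnj a * cis s) > 0"
    proof -
      have "norm (cnj a * cis s) < 1" using as[OF a] by (simp add: norm_mult)
      then show ?thesis by (metis eq_iff_diff_eq_0 norm_one order_less_irrefl zero_less_norm_iff)
    qed
    have "1 / (4 * \<epsilon>) = \<epsilon> / (2 * \<epsilon>)\<^sup>2" using e by (simp add: power2_eq_square)
    also have "\<dots> \<le> (1 - (norm a)\<^sup>2) / (norm (1 - cnj a * cis s))\<^sup>2"
    proof (rule frac_le)
      show le: "\<epsilon> \<le> 1 - (norm a)\<^sup>2"
        using as[OF a] by (simp add: \<epsilon>_def power2_eq_square mult_left_le_one_le)
      show "0 \<le> 1 - (norm a)\<^sup>2" using le e by linarith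
      show "0 < (norm (1 - cnj a * cis s))\<^sup>2" using n0 by simp
      show "(norm (1 - cnj a * cis s))\<^sup>2 \<le> (2 * \<epsilon>)\<^sup>2" using n n0 by (intro power_mono) auto
    qed
    also have "\<dots> \<le> norm (blaschke_deriv as (cis s))"
      by (rule norm_blaschke_deriv_circle_ge[OF as _ a]) auto
    finally show ?thesis .
  qed
  have "ennreal ((1 / (4 * \<epsilon>)) powr P) * ennreal \<epsilon> = (\<integral>\<^sup>+s. ennreal ((1 / (4 * \<epsilon>)) powr P) * indicator {u..u+\<epsilon>} s \<partial>lborel)"
    using e by (subst nn_integral_cmult_indicator) auto
  also have "\<dots> \<le> (\<integral>\<^sup>+s\<in>{0..2*pi}. g s \<partial>lborel)"
  proof (rule nn_integral_mono_AE)
    show "AE s in lborel. ennreal ((1 / (4 * \<epsilon>)) powr P) * indicator {u..u+\<epsilon>} s \<le> g s * indicator {0..2*pi} s"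
      using g
    proof eventually_elim
      case (elim s)
      show ?case
      proof (cases "s \<in> {u..u+\<epsilon>}")
        case True
        have "ennreal ((1 / (4 * \<epsilon>)) powr P) \<le> ennreal (norm (blaschke_deriv as (cis s)) powr P)"
          using bound[OF True] e P by (intro ennreal_leI powr_mono2) auto
        also have "\<dots> \<le> g s" using elim J True by blast
        finally show ?thesis using True J by (auto simp: indicator_def)
      qed simp
    qed
  qed
  finally have "ennreal (4 powr P) * (ennreal ((1 / (4 * \<epsilon>)) powr P) * ennreal \<epsilon>) \<le> ennreal (4 powr P) * (\<integral>\<^sup>+s\<in>{0..2*pi}. g s \<partial>lborel)"
    by (rule mult_left_mono) simp
  also have "ennreal (4 powr P) * (ennreal ((1 / (4 * \<epsilon>)) powr P) * ennreal \<epsilon>) = ennreal (\<epsilon> powr (1 - P))"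
  proof -
    have "4 powr P * ((1 / (4 * \<epsilon>)) powr P * \<epsilon>) = \<epsilon> powr (1 - P)"
      using e by (simp add: powr_divide powr_mult powr_diff)
    then show ?thesis using e by (simp flip: ennreal_mult)
  qed
  finally show ?thesis by (simp add: \<epsilon>_def)
qed

text \<open>If \<open>\<epsilon>\<close> is the distance of the zeros to the circle and \<open>P > 1\<close>, the constant \<open>\<epsilon> powr (1 - P)\<close>
  separates the two sides, up to factors depending on \<open>m\<close> and \<open>P\<close> only.\<close>
proposition blaschke_dirichlet_le_circle_integral:
  fixes P :: real
  assumes P: "0 < P"
  obtains C :: real where "C \<ge> 0"
    "\<And>as K g. \<lbrakk>\<And>a. a \<in> set as \<Longrightarrow> norm a < 1; length as \<le> m;
       AE s in lborel. s \<in> {0..2*pi} \<longrightarrow> ennreal (norm (blaschke_deriv as (cis s)) powr P) \<le> g s\<rbrakk>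
     \<Longrightarrow> ennreal (\<Sum>k<K. (real k + 1) powr P * (norm (taylor_coeff (blaschke as) k))\<^sup>2)
          \<le> ennreal C * (1 + (\<integral>\<^sup>+s\<in>{0..2*pi}. g s \<partial>lborel))"
proof
  define M :: real where "M = 6 * real m * 49 ^ m"
  define c where "c = (4 * (P - 1)) powr (P - 1)"
  \<comment> \<open>The summand for k = 0 is at most \<open>49 ^ m\<close>; for k \<ge> 1, k + 1
    \<le> 2k costs the factor \<open>2 powr P\<close>. \<open>M\<close> bounds the energy, and
    \<open>c * M * 4 powr P\<close> belongs to the case P > 1.\<close>
  define C where "C = 49 ^ m + 2 powr P * (M + c * M * 4 powr P)"
  have M0: "0 \<le> M" and c0: "0 \<le> c" by (auto simp: M_def c_def)
  show "C \<ge> 0" unfolding C_def using M0 c0 by (intro add_nonneg_nonneg mult_nonneg_nonneg) auto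
  fix as K and g :: "real \<Rightarrow> ennreal"
  assume as: "\<And>a. a \<in> set as \<Longrightarrow> norm a < 1" and m: "length as \<le> m"
    and g: "AE s in lborel. s \<in> {0..2*pi} \<longrightarrow> ennreal (norm (blaschke_deriv as (cis s)) powr P) \<le> g s"
  define I where "I = (\<integral>\<^sup>+s\<in>{0..2*pi}. g s \<partial>lborel)"
  define b where "b = (\<lambda>k. (norm (taylor_coeff (blaschke as) k))\<^sup>2)"
  have b0: "0 \<le> b k" for k by (simp add: b_def)
  \<comment> \<open>The inserted 1 covers the empty list of zeros and does not change the minimum
    otherwise.\<close>
  define \<epsilon> where "\<epsilon> = Min (insert 1 ((\<lambda>a. 1 - norm a) ` set as))"
  have e: "0 < \<epsilon>" "\<epsilon> \<le> 1" using as by (auto simp: \<epsilon>_def)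
  have "\<epsilon> \<le> 1 - norm a" if "a \<in> set as" for a
    unfolding \<epsilon>_def using that by (intro Min_le) auto
  then have ae: "norm a \<le> 1 - \<epsilon>" if "a \<in> set as" for a using that by fastforce
  define E where "E = (\<lambda>k. real k * b k * (1 + \<epsilon>/2) ^ (2 * k))"
  have E0: "0 \<le> E k" for k using e b0 by (simp add: E_def)
  have len: "real (length as) * 49 ^ length as \<le> real m * 49 ^ m"
    using m by (intro mult_mono) (auto intro: power_increasing)
  have E: "(\<Sum>k<K. E k) \<le> 6 * real (length as) * 49 ^ length as"
    unfolding E_def b_def by (rule blaschke_dirichlet_energy_le[OF ae e])
  have EM: "(\<Sum>k<K. E k) \<le> M" using E len by (simp add: M_def)
  have "ennreal (\<Sum>k<K. real k powr P * b k) \<le> ennreal (M + c * M * 4 powr P) * (1 + I)"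
  proof (cases "P \<le> 1")
    \<comment> \<open>Here k^P \<le> k, so the energy alone bounds the sum and the integral plays no
      part.\<close>
    case True
    have "(\<Sum>k<K. real k powr P * b k) \<le> (\<Sum>k<K. E k)"
    proof (rule sum_mono)
      fix k
      have "real k powr P \<le> real k"
      proof (cases "k = 0")
        case False
        then have "real k powr P \<le> real k powr 1" using True by (intro powr_mono) auto
        then show ?thesis by simp
      qed simp
      also have "\<dots> \<le> real k * (1 + \<epsilon>/2) ^ (2 * k)"
        using mult_left_mono[OF one_le_power[of "1 + \<epsilon>/2" "2 * k"], of "real k"] e by simp
      finally show "real k powr P * b k \<le> E k"
        unfolding E_def using mult_right_mono[OF _ b0] by (metis mult.assoc mult.commute)
    qed
    also have "\<dots> \<le> M + c * M * 4 powr P" using EM c0 M0 by (simp add: add_increasing2)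
    finally have "ennreal (\<Sum>k<K. real k powr P * b k) \<le> ennreal (M + c * M * 4 powr P) * 1"
      by (simp add: ennreal_leI)
    also have "\<dots> \<le> ennreal (M + c * M * 4 powr P) * (1 + I)" by (intro mult_left_mono) auto
    finally show ?thesis .
  next
    case False
    have "(\<Sum>k<K. real k powr P * b k) \<le> (\<Sum>k<K. c * \<epsilon> powr (1 - P) * E k)"
    proof (rule sum_mono)
      fix k
      have "real k powr P * b k \<le> (c * \<epsilon> powr (1 - P) * (real k * (1 + \<epsilon>/2) ^ (2 * k))) * b k"
        using powr_le_geometric_growth[OF _ e, of P k] False b0 unfolding c_def by (intro mult_right_mono) auto
      then show "real k powr P * b k \<le> c * \<epsilon> powr (1 - P) * E k" by (simp add: E_def mult_ac)
    qed
    also have "\<dots> = c * \<epsilon> powr (1 - P) * (\<Sum>k<K. E k)" by (simp add: sum_distrib_left)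
    finally have *: "(\<Sum>k<K. real k powr P * b k) \<le> c * \<epsilon> powr (1 - P) * (\<Sum>k<K. E k)" .
    show ?thesis
    proof (cases "as = []")
      \<comment> \<open>There is no zero to produce the lower bound, but the energy estimate, which
        has \<open>length as\<close> as a factor, makes the sum vanish.\<close>
      case True
      then have "(\<Sum>k<K. E k) = 0" using E E0 by (simp add: sum_nonneg order_antisym)
      then show ?thesis using * by (simp add: ennreal_neg)
    next
      case False
      then have "\<epsilon> \<in> insert 1 ((\<lambda>a. 1 - norm a) ` set as)" unfolding \<epsilon>_def by (intro Min_in) auto
      then obtain a where a: "a \<in> set as" "\<epsilon> = 1 - norm a"
      proof (cases "\<epsilon> \<in> (\<lambda>a. 1 - norm a) ` set as")
        \<comment> \<open>If only the inserted 1 could attain the minimum, every zero would be the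
          origin, and then any of them attains it after all.\<close>
        case False
        then have "\<epsilon> = 1" using \<open>\<epsilon> \<in> _\<close> by simp
        moreover obtain a where "a \<in> set as" using \<open>as \<noteq> []\<close> by (meson list.set_sel(1))
        moreover have "norm a = 0" using ae[of a] \<open>\<epsilon> = 1\<close> \<open>a \<in> set as\<close> by simp
        ultimately show ?thesis using that by auto
      qed (use that in auto)
      have "(\<Sum>k<K. real k powr P * b k) \<le> c * \<epsilon> powr (1 - P) * M"
        using * EM c0 by (meson mult_left_mono mult_nonneg_nonneg order_trans powr_ge_zero)
      then have "ennreal (\<Sum>k<K. real k powr P * b k) \<le> ennreal (c * M * \<epsilon> powr (1 - P))"
        by (simp add: ennreal_leI mult_ac)
      also have "\<dots> = ennreal (c * M) * ennreal (\<epsilon> powr (1 - P))" using c0 M0 by (simp add: ennreal_mult)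
      also have "\<dots> \<le> ennreal (c * M) * (ennreal (4 powr P) * I)"
        unfolding I_def a(2) by (intro mult_left_mono blaschke_circle_integral_ge[OF as a(1) P g]) auto
      also have "\<dots> = ennreal (c * M * 4 powr P) * I" using c0 M0 by (simp add: ennreal_mult mult.assoc)
      also have "\<dots> \<le> ennreal (M + c * M * 4 powr P) * (1 + I)"
        using c0 M0 by (intro mult_mono ennreal_leI) auto
      finally show ?thesis .
    qed
  qed
  then have "ennreal (2 powr P * (\<Sum>k<K. real k powr P * b k)) \<le> ennreal (2 powr P) * (ennreal (M + c * M * 4 powr P) * (1 + I))"
    using b0 by (subst ennreal_mult) (auto intro!: sum_nonneg mult_left_mono)
  also have "\<dots> = ennreal (2 powr P * (M + c * M * 4 powr P)) * (1 + I)"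
    using M0 c0 by (subst ennreal_mult) (auto simp: mult.assoc)
  finally have main: "ennreal (2 powr P * (\<Sum>k<K. real k powr P * b k)) \<le> ennreal (2 powr P * (M + c * M * 4 powr P)) * (1 + I)" .
  have b00: "b 0 \<le> 49 ^ m"
  proof -
    have "norm (blaschke as 0) \<le> 7 ^ length as" by (rule norm_blaschke_le[OF ae]) (use e in auto)
    also have "\<dots> \<le> 7 ^ m" using m by (rule power_increasing) simp
    finally have "b 0 \<le> (7 ^ m)\<^sup>2" unfolding b_def by (intro power_mono) (auto simp: taylor_coeff_def)
    then show ?thesis by (simp add: power_mult[symmetric] mult.commute[of m] power_mult)
  qed
  have "(\<Sum>k<K. (real k + 1) powr P * b k) \<le> (\<Sum>k<K. (if k = 0 then b 0 else 0) + 2 powr P * (real k powr P * b k))"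
  proof (rule sum_mono)
    fix k
    show "(real k + 1) powr P * b k \<le> (if k = 0 then b 0 else 0) + 2 powr P * (real k powr P * b k)"
    proof (cases "k = 0")
      case False
      then have "(real k + 1) powr P \<le> (2 * real k) powr P" using P by (intro powr_mono2) auto
      then show ?thesis using b0[of k] False mult_right_mono[OF _ b0, of "(real k + 1) powr P" "(2 * real k) powr P" k]
        by (simp add: powr_mult mult.assoc)
    qed simp
  qed
  also have "\<dots> \<le> 49 ^ m + 2 powr P * (\<Sum>k<K. real k powr P * b k)"
  proof -
    have "(\<Sum>k<K. (if k = 0 then b 0 else 0)) \<le> 49 ^ m"
      using b00 by (cases "K = 0") (auto simp: sum.delta')
    then show ?thesis by (simp add: sum.distrib sum_distrib_left)
  qed
  finally have "ennreal (\<Sum>k<K. (real k + 1) powr P * b k) \<le> ennreal (49 ^ m + 2 powr P * (\<Sum>k<K. real k powr P * b k))"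
    by (rule ennreal_leI)
  also have "\<dots> = ennreal (49 ^ m) + ennreal (2 powr P * (\<Sum>k<K. real k powr P * b k))"
    using b0 by (intro ennreal_plus) (auto intro!: sum_nonneg mult_nonneg_nonneg)
  also have "\<dots> \<le> ennreal (49 ^ m) * (1 + I) + ennreal (2 powr P * (M + c * M * 4 powr P)) * (1 + I)"
    using mult_left_mono[of 1 "1 + I" "ennreal (49 ^ m)"] by (intro add_mono main) simp
  also have "\<dots> = ennreal C * (1 + I)"
    unfolding C_def using M0 c0 by (subst ennreal_plus) (auto simp: distrib_right intro!: mult_nonneg_nonneg add_nonneg_nonneg)
  finally show "ennreal (\<Sum>k<K. (real k + 1) powr P * (norm (taylor_coeff (blaschke as) k))\<^sup>2)
          \<le> ennreal C * (1 + (\<integral>\<^sup>+s\<in>{0..2*pi}. g s \<partial>lborel))"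
    by (simp add: b_def I_def)
qed

subsection \<open>One-variable slices\<close>

text \<open>As q(0) is nonzero, the reflection \<open>Q\<close> has exact degree m, even if q has
  smaller degree. If \<open>L\<close> lists its zeros, then q(z) is q(0) times the product of the 1
  - conj(a) z. A zero with |a| > 1 would give q the zero 1 / conj(a) in the disc, and a zero on the
  circle contributes only a unimodular constant, so what is left is a Blaschke product.\<close>

lemma reflection_eq_blaschke:
  fixes q :: "nat \<Rightarrow> complex"
  assumes nz: "\<And>z. norm z < 1 \<Longrightarrow> (\<Sum>j\<le>m. q j * z ^ j) \<noteq> 0"
  obtains u as where "norm u = 1" "length as \<le> m" "\<And>a. a \<in> set as \<Longrightarrow> norm a < 1"
    "\<And>z. (\<Sum>j\<le>m. q j * z ^ j) \<noteq> 0 \<Longrightarrow>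
       (\<Sum>j\<le>m. cnj (q (m - j)) * z ^ j) / (\<Sum>j\<le>m. q j * z ^ j) = u * blaschke as z"
    "\<And>z a. (\<Sum>j\<le>m. q j * z ^ j) \<noteq> 0 \<Longrightarrow> a \<in> set as \<Longrightarrow> 1 - cnj a * z \<noteq> 0"
proof -
  define Q where "Q = (\<Sum>j\<le>m. monom (cnj (q (m - j))) j)"
  have polyQ: "poly Q z = (\<Sum>j\<le>m. cnj (q (m - j)) * z ^ j)" for z
    by (simp add: Q_def poly_sum poly_monom)
  have q0: "q 0 \<noteq> 0" using nz[of 0] by (simp add: power_0_left sum.delta' if_distrib cong: if_cong)
  have coeffQ: "coeff Q i = (if i \<le> m then cnj (q (m - i)) else 0)" for i
    by (simp add: Q_def coeff_sum coeff_monom sum.delta')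
  have "degree Q \<le> m" by (rule degree_le) (simp add: coeffQ)
  moreover have "degree Q \<ge> m" by (rule le_degree) (simp add: coeffQ q0)
  ultimately have degQ: "degree Q = m" by simp
  then have leadQ: "lead_coeff Q = cnj (q 0)" by (simp add: coeffQ)
  have "Q \<noteq> 0" using leadQ q0 by auto
  then obtain A where A: "size A = degree Q" "Q = smult (lead_coeff Q) (\<Prod>x\<in>#A. [:-x, 1:])"
    using alg_closed_imp_factorization[of Q] by blast
  obtain L where L: "mset L = A" using ex_mset by blast
  have lenL: "length L = m" using A(1) L degQ by (metis size_mset)
  have fac1: "poly Q z = cnj (q 0) * (\<Prod>a\<leftarrow>L. z - a)" for z
  proof -
    have "poly (prod_list (map (\<lambda>x. [:-x, 1:]) L)) z = (\<Prod>a\<leftarrow>L. z - a)"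
      by (induction L) (auto simp: algebra_simps)
    moreover have "Q = smult (cnj (q 0)) (prod_list (map (\<lambda>x. [:-x, 1:]) L))"
      using A(2) unfolding leadQ L[symmetric] by (simp add: prod_mset_prod_list[symmetric] flip: mset_map)
    ultimately show ?thesis by simp
  qed
  have fac2: "(\<Sum>j\<le>m. q j * z ^ j) = q 0 * (\<Prod>a\<leftarrow>L. 1 - cnj a * z)" for z
  proof (cases "z = 0")
    case True
    have "(\<Prod>a\<leftarrow>L. 1 - cnj a * 0) = 1" by (induction L) auto
    then show ?thesis using True by (simp add: power_0_left sum.delta' if_distrib cong: if_cong)
  next
    case False
    have "(\<Sum>j\<le>m. q j * z ^ j) = (\<Sum>j\<le>m. q (m - j) * z ^ (m - j))"
      by (rule sum.reindex_bij_witness[of _ "\<lambda>j. m - j" "\<lambda>j. m - j"]) auto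
    \<comment> \<open>Reflecting twice returns q, which carries the factorisation of
      \<open>Q\<close> over to q.\<close>
    also have "\<dots> = z ^ m * cnj (poly Q (1 / cnj z))"
      unfolding polyQ cnj_sum sum_distrib_left
      by (rule sum.cong) (use False in \<open>auto simp: power_diff power_divide\<close>)
    also have "\<dots> = q 0 * (z ^ length L * cnj (\<Prod>a\<leftarrow>L. 1 / cnj z - a))"
      unfolding fac1 lenL by simp
    also have "z ^ length L * cnj (\<Prod>a\<leftarrow>L. 1 / cnj z - a) = (\<Prod>a\<leftarrow>L. 1 - cnj a * z)"
    proof (induction L)
      case (Cons a L)
      have "z * cnj (1 / cnj z - a) = 1 - cnj a * z" using False by (simp add: field_simps)
      then show ?case using Cons.IH
        by (simp only: list.map prod_list.Cons length_Cons power_Suc complex_cnj_mult) (metis mult.assoc mult.left_commute)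
    qed simp
    finally show ?thesis .
  qed
  have prod_nz: "1 - cnj a * z \<noteq> 0" if "(\<Sum>j\<le>m. q j * z ^ j) \<noteq> 0" "a \<in> set L" for a z
  proof
    assume "1 - cnj a * z = 0"
    with that(2) have "0 \<in> set (map (\<lambda>a. 1 - cnj a * z) L)" by force
    then have "(\<Prod>a\<leftarrow>L. 1 - cnj a * z) = 0" using prod_list_zero_iff by blast
    then show False using that(1) fac2 by simp
  qed
  have L1: "norm a \<le> 1" if "a \<in> set L" for a
  proof (rule ccontr)
    assume "\<not> norm a \<le> 1"
    then have "norm (1 / cnj a) < 1" "a \<noteq> 0" by (auto simp: norm_divide divide_simps)
    from prod_nz[OF nz[OF this(1)] that] this(2) show False by simp
  qed
  define as where "as = filter (\<lambda>a. norm a < 1) L"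
  define u where "u = cnj (q 0) / q 0 * (\<Prod>a\<leftarrow>filter (\<lambda>a. \<not> norm a < 1) L. - a)"
  have split: "(\<Prod>a\<leftarrow>L'. z - a) / (\<Prod>a\<leftarrow>L'. 1 - cnj a * z) =
      (\<Prod>a\<leftarrow>filter (\<lambda>a. \<not> norm a < 1) L'. - a) * blaschke (filter (\<lambda>a. norm a < 1) L') z"
    if "\<And>a. a \<in> set L' \<Longrightarrow> norm a \<le> 1" "\<And>a. a \<in> set L' \<Longrightarrow> 1 - cnj a * z \<noteq> 0" for L' z
    using that
  proof (induction L')
    case (Cons a L')
    have *: "(\<Prod>a\<leftarrow>a # L'. z - a) / (\<Prod>a\<leftarrow>a # L'. 1 - cnj a * z) =
      (z - a) / (1 - cnj a * z) * ((\<Prod>a\<leftarrow>L'. z - a) / (\<Prod>a\<leftarrow>L'. 1 - cnj a * z))" by simp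
    show ?case
    proof (cases "norm a < 1")
      case True
      then show ?thesis unfolding * using Cons by (simp add: blaschke_factor_def)
    next
      case False
      \<comment> \<open>A common zero of q and its reflection on the circle: the quotient of the two
        linear factors is the constant \<open>- a\<close>.\<close>
      then have "norm a = 1" using Cons.prems(1)[of a] by simp
      then have "a * cnj a = 1" by (simp flip: complex_norm_square)
      then have "z - a = - a * (1 - cnj a * z)" by (simp add: algebra_simps flip: mult.assoc)
      then have "(z - a) / (1 - cnj a * z) = - a" using Cons.prems(2)[of a] by simp
      then show ?thesis unfolding * using Cons False by simp
    qed
  qed simp
  have prod1: "norm (\<Prod>a\<leftarrow>L'. - a) = 1" if "\<And>a. a \<in> set L' \<Longrightarrow> norm a = 1" for L' :: "complex list"
    using that by (induction L') (auto simp: norm_mult)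
  show ?thesis
  proof (rule that[of u as])
    have "norm (\<Prod>a\<leftarrow>filter (\<lambda>a. \<not> norm a < 1) L. - a) = 1"
      using L1 by (intro prod1) fastforce
    then show "norm u = 1" using q0 by (simp only: u_def norm_mult norm_divide complex_mod_cnj) simp
    show "length as \<le> m" unfolding as_def using lenL by (metis length_filter_le)
    show "norm a < 1" if "a \<in> set as" for a using that by (simp add: as_def)
    show "1 - cnj a * z \<noteq> 0" if "(\<Sum>j\<le>m. q j * z ^ j) \<noteq> 0" "a \<in> set as" for z a
      using prod_nz that by (simp add: as_def)
    fix z assume z: "(\<Sum>j\<le>m. q j * z ^ j) \<noteq> 0"
    have "(\<Sum>j\<le>m. cnj (q (m - j)) * z ^ j) / (\<Sum>j\<le>m. q j * z ^ j) =
        cnj (q 0) / q 0 * ((\<Prod>a\<leftarrow>L. z - a) / (\<Prod>a\<leftarrow>L. 1 - cnj a * z))"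
      unfolding polyQ[symmetric] fac1 fac2 by simp
    also have "\<dots> = u * blaschke as z"
      using split[of L z] prod_nz[OF z] L1 by (simp add: u_def as_def)
    finally show "(\<Sum>j\<le>m. cnj (q (m - j)) * z ^ j) / (\<Sum>j\<le>m. q j * z ^ j) = u * blaschke as z" .
  qed
qed

lemma AE_cis_nonroot:
  fixes q :: "nat \<Rightarrow> complex"
  assumes "(\<Sum>j\<le>m. q j * z0 ^ j) \<noteq> 0"
  shows "AE s in lborel. s \<in> {0..2*pi} \<longrightarrow> (\<Sum>j\<le>m. q j * cis s ^ j) \<noteq> 0"
proof -
  define Z where "Z = {z. (\<Sum>j\<le>m. q j * z ^ j) = 0}"
  have "finite Z"
  proof -
    define Q where "Q = (\<Sum>j\<le>m. monom (q j) j)"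
    have "poly Q z = (\<Sum>j\<le>m. q j * z ^ j)" for z by (simp add: Q_def poly_sum poly_monom)
    moreover from this have "Q \<noteq> 0" using assms by (metis poly_0)
    ultimately show ?thesis unfolding Z_def using poly_roots_finite[of Q] by simp
  qed
  moreover have "inj_on cis {0..<2*pi}"
  proof (rule inj_on_inverseI)
    fix s assume "s \<in> {0..<2*pi}"
    then show "Arg2pi (cis s) = s" by (intro Arg2pi_unique[of 1]) (auto simp: cis_conv_exp)
  qed
  ultimately have "finite (cis -` Z \<inter> {0..<2*pi})" by (rule finite_vimage_IntI)
  \<comment> \<open>\<open>cis\<close> is injective only on the half-open interval, so the endpoint
    is added by hand.\<close>
  then have "finite (insert (2*pi) (cis -` Z \<inter> {0..<2*pi}))" by simp
  then have "insert (2*pi) (cis -` Z \<inter> {0..<2*pi}) \<in> null_sets lborel"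
    by (rule finite_imp_null_set_lborel)
  from AE_not_in[OF this] show ?thesis
    by eventually_elim (auto simp: Z_def)
qed

text \<open>\<open>C\<close> is fixed before \<open>q\<close>, hence is uniform over all slices.
  \<open>f\<close> is a total function that takes the value 0 where \<open>q\<close> vanishes, so
  its derivative is compared with \<open>g\<close> only away from those points; on the circle they
  are finite in number.\<close>

proposition slice_dirichlet_le_circle_integral:
  fixes P :: real
  assumes P: "0 < P"
  obtains C :: real where "C \<ge> 0"
    "\<And>(q :: nat \<Rightarrow> complex) w f K g. \<lbrakk>\<And>z. norm z < 1 \<Longrightarrow> (\<Sum>j\<le>m. q j * z ^ j) \<noteq> 0; norm w = 1;
       \<And>z. f z = w * (\<Sum>j\<le>m. cnj (q (m - j)) * z ^ j) / (\<Sum>j\<le>m. q j * z ^ j);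
       \<And>s. \<lbrakk>s \<in> {0..2*pi}; (\<Sum>j\<le>m. q j * cis s ^ j) \<noteq> 0\<rbrakk> \<Longrightarrow> ennreal (norm (deriv f (cis s)) powr P) \<le> g s\<rbrakk>
     \<Longrightarrow> ennreal (\<Sum>k<K. (real k + 1) powr P * (norm (taylor_coeff f k))\<^sup>2)
          \<le> ennreal C * (1 + (\<integral>\<^sup>+s\<in>{0..2*pi}. g s \<partial>lborel))"
proof -
  obtain C where C: "C \<ge> 0"
    "\<And>as K g. \<lbrakk>\<And>a. a \<in> set as \<Longrightarrow> norm a < 1; length as \<le> m;
       AE s in lborel. s \<in> {0..2*pi} \<longrightarrow> ennreal (norm (blaschke_deriv as (cis s)) powr P) \<le> g s\<rbrakk>
     \<Longrightarrow> ennreal (\<Sum>k<K. (real k + 1) powr P * (norm (taylor_coeff (blaschke as) k))\<^sup>2)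
          \<le> ennreal C * (1 + (\<integral>\<^sup>+s\<in>{0..2*pi}. g s \<partial>lborel))"
    using blaschke_dirichlet_le_circle_integral[OF P, of m] by blast
  show ?thesis
  proof (rule that[OF C(1)])
    fix q :: "nat \<Rightarrow> complex" and w f K g
    assume nz: "\<And>z. norm z < 1 \<Longrightarrow> (\<Sum>j\<le>m. q j * z ^ j) \<noteq> 0" and w: "norm w = 1"
      and f: "\<And>z. f z = w * (\<Sum>j\<le>m. cnj (q (m - j)) * z ^ j) / (\<Sum>j\<le>m. q j * z ^ j)"
      and g: "\<And>s. \<lbrakk>s \<in> {0..2*pi}; (\<Sum>j\<le>m. q j * cis s ^ j) \<noteq> 0\<rbrakk> \<Longrightarrow> ennreal (norm (deriv f (cis s)) powr P) \<le> g s"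
    obtain u as where ua: "norm u = 1" "length as \<le> m" "\<And>a. a \<in> set as \<Longrightarrow> norm a < 1"
      and fB: "\<And>z. (\<Sum>j\<le>m. q j * z ^ j) \<noteq> 0 \<Longrightarrow>
         (\<Sum>j\<le>m. cnj (q (m - j)) * z ^ j) / (\<Sum>j\<le>m. q j * z ^ j) = u * blaschke as z"
      and az: "\<And>z a. (\<Sum>j\<le>m. q j * z ^ j) \<noteq> 0 \<Longrightarrow> a \<in> set as \<Longrightarrow> 1 - cnj a * z \<noteq> 0"
      using reflection_eq_blaschke[OF nz] by blast
    have fB': "f z = w * u * blaschke as z" if "(\<Sum>j\<le>m. q j * z ^ j) \<noteq> 0" for z
      unfolding f times_divide_eq_right[symmetric] fB[OF that] by (simp add: mult.assoc)
    have op: "open {z. (\<Sum>j\<le>m. q j * z ^ j) \<noteq> 0}"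
      by (intro open_Collect_neq continuous_intros)
    have df: "deriv f z = w * u * blaschke_deriv as z" if z: "(\<Sum>j\<le>m. q j * z ^ j) \<noteq> 0" for z
    proof (rule DERIV_imp_deriv)
      have "((\<lambda>z. w * u * blaschke as z) has_field_derivative w * u * blaschke_deriv as z) (at z)"
        by (intro DERIV_cmult blaschke_has_derivative az[OF z])
      then show "(f has_field_derivative w * u * blaschke_deriv as z) (at z)"
        by (rule has_field_derivative_transform_within_open[OF _ op]) (use z fB' in auto)
    qed
    have "AE s in lborel. s \<in> {0..2*pi} \<longrightarrow> ennreal (norm (blaschke_deriv as (cis s)) powr P) \<le> g s"
      using AE_cis_nonroot[OF nz[of 0]]
    proof (rule AE_mp)
      show "AE s in lborel. (s \<in> {0..2*pi} \<longrightarrow> (\<Sum>j\<le>m. q j * cis s ^ j) \<noteq> 0) \<longrightarrow>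
         s \<in> {0..2*pi} \<longrightarrow> ennreal (norm (blaschke_deriv as (cis s)) powr P) \<le> g s"
        using g df w ua(1) by (intro AE_I2) (auto simp: norm_mult)
    qed simp
    from C(2)[OF ua(3) ua(2) this]
    have "ennreal (\<Sum>k<K. (real k + 1) powr P * (norm (taylor_coeff (blaschke as) k))\<^sup>2)
          \<le> ennreal C * (1 + (\<integral>\<^sup>+s\<in>{0..2*pi}. g s \<partial>lborel))" .
    moreover have "norm (taylor_coeff f k) = norm (taylor_coeff (blaschke as) k)" for k
    proof -
      have "(blaschke as has_field_derivative blaschke_deriv as z) (at z)" if "norm z < 1" for z
        by (rule blaschke_has_derivative[OF az[OF nz[OF that]]])
      then have hol: "blaschke as holomorphic_on ball 0 1"
        unfolding holomorphic_on_open[OF open_ball] by (metis mem_ball_0)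
      have "(deriv ^^ k) f 0 = (deriv ^^ k) (\<lambda>z. w * u * blaschke as z) 0"
        by (rule higher_deriv_cong_ev)
           (auto intro!: eventually_nhds_in_open[OF open_ball, of 0 0 1, THEN eventually_mono] fB' nz)
      also have "\<dots> = w * u * (deriv ^^ k) (blaschke as) 0"
        by (rule higher_deriv_cmult[OF hol]) auto
      finally show ?thesis using w ua(1) by (simp add: taylor_coeff_def norm_mult norm_divide)
    qed
    ultimately show "ennreal (\<Sum>k<K. (real k + 1) powr P * (norm (taylor_coeff f k))\<^sup>2)
          \<le> ennreal C * (1 + (\<integral>\<^sup>+s\<in>{0..2*pi}. g s \<partial>lborel))" by simp
  qed
qed

subsection \<open>Zeros of the denominator\<close>

lemma taylor_coeff_eq_fps_nth: "f has_fps_expansion F \<Longrightarrow> taylor_coeff f k = fps_nth F k"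
  by (simp add: taylor_coeff_def fps_nth_fps_expansion)

lemma analytic_has_fps_expansion_taylor:
  assumes "f analytic_on {0}"
  shows "f has_fps_expansion Abs_fps (taylor_coeff f)"
proof -
  have "f has_fps_expansion fps_expansion f 0"
    using analytic_at_imp_has_fps_expansion[OF assms] by simp
  then show ?thesis by (simp add: fps_expansion_def taylor_coeff_def [abs_def])
qed

lemma taylor_coeff_mult:
  assumes "f analytic_on {0}" "g analytic_on {0}"
  shows "taylor_coeff (\<lambda>z. f z * g z) k = (\<Sum>i\<le>k. taylor_coeff f i * taylor_coeff g (k - i))"
  using taylor_coeff_eq_fps_nth[OF has_fps_expansion_mult[OF assms[THEN analytic_has_fps_expansion_taylor]]]
  by (simp add: fps_mult_nth atLeast0AtMost)

lemma taylor_coeff_sum: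
  assumes "\<And>i. i \<in> I \<Longrightarrow> f i analytic_on {0}"
  shows "taylor_coeff (\<lambda>z. \<Sum>i\<in>I. f i z) k = (\<Sum>i\<in>I. taylor_coeff (f i) k)"
  using taylor_coeff_eq_fps_nth[OF has_fps_expansion_sum[OF analytic_has_fps_expansion_taylor[OF assms]]]
  by (simp add: fps_sum_nth)

lemma taylor_coeff_poly:
  "taylor_coeff (\<lambda>z. \<Sum>j\<le>m. x j * z ^ j) k = (if k \<le> m then x k else 0)"
proof -
  have "(\<lambda>z. \<Sum>j\<le>m. x j * z ^ j) has_fps_expansion (\<Sum>j\<le>m. fps_const (x j) * fps_X ^ j)"
    by (intro fps_expansion_intros)
  from taylor_coeff_eq_fps_nth[OF this] show ?thesis
    by (simp add: fps_sum_nth fps_X_power_nth if_distrib sum.delta' cong: if_cong)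
qed

lemma taylor_coeff_cong:
  assumes "eventually (\<lambda>z. f z = g z) (nhds 0)"
  shows "taylor_coeff f k = taylor_coeff g k"
  unfolding taylor_coeff_def using higher_deriv_cong_ev[OF assms refl] by simp

section \<open>Slices with the second variable fixed\<close>

definition slice_coeff :: "(nat \<Rightarrow> nat \<Rightarrow> complex) \<Rightarrow> nat \<Rightarrow> complex \<Rightarrow> nat \<Rightarrow> complex" where
  "slice_coeff c n w j = (\<Sum>k\<le>n. c j k * w ^ k)"

lemma bipoly_slice: "bipoly c m n z w = (\<Sum>j\<le>m. slice_coeff c n w j * z ^ j)"
  unfolding bipoly_def slice_coeff_def sum_distrib_right by (simp add: mult_ac)

text \<open>On the circle 1 / conj(w) = w, so reflecting in both variables and then fixing w is, up
  to the unimodular factor \<open>w ^ n\<close>, the one-variable reflection of the slice.\<close>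

lemma bipoly_refl_slice:
  assumes w: "norm w = 1"
  shows "bipoly (refl_coeff c m n) m n z w = w ^ n * (\<Sum>j\<le>m. cnj (slice_coeff c n w (m - j)) * z ^ j)"
proof -
  have ww: "w * cnj w = 1" using w by (simp flip: complex_norm_square)
  have "slice_coeff (refl_coeff c m n) n w j = w ^ n * cnj (slice_coeff c n w (m - j))" if "j \<le> m" for j
  proof -
    have "w ^ n * cnj (slice_coeff c n w (m - j)) = (\<Sum>k\<le>n. cnj (c (m - j) k) * (w ^ n * cnj w ^ k))"
      by (simp add: slice_coeff_def sum_distrib_left mult_ac)
    also have "\<dots> = (\<Sum>k\<le>n. cnj (c (m - j) k) * w ^ (n - k))"
    proof (rule sum.cong[OF refl])
      fix k assume "k \<in> {..n}"
      then have "w ^ n * cnj w ^ k = w ^ (n - k) * (w * cnj w) ^ k"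
        by (simp add: power_mult_distrib flip: power_add mult.assoc)
      then show "cnj (c (m - j) k) * (w ^ n * cnj w ^ k) = cnj (c (m - j) k) * w ^ (n - k)" by (simp add: ww)
    qed
    also have "\<dots> = (\<Sum>k\<le>n. cnj (c (m - j) (n - k)) * w ^ k)"
      by (rule sum.reindex_bij_witness[of _ "\<lambda>k. n - k" "\<lambda>k. n - k"]) auto
    also have "\<dots> = slice_coeff (refl_coeff c m n) n w j"
      unfolding slice_coeff_def using that by (intro sum.cong) (auto simp: refl_coeff_def)
    finally show ?thesis ..
  qed
  then show ?thesis unfolding bipoly_slice sum_distrib_left by (intro sum.cong) (auto simp: mult_ac)
qed

lemma poly_coeffs_zero_of_zero_on_disc:
  fixes x :: "nat \<Rightarrow> complex"
  assumes "\<And>z. norm z < 1 \<Longrightarrow> (\<Sum>j\<le>m. x j * z ^ j) = 0" and "j \<le> m"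
  shows "x j = 0"
proof -
  have "eventually (\<lambda>z. (\<Sum>j\<le>m. x j * z ^ j) = 0) (nhds 0)"
    by (rule eventually_mono[OF eventually_nhds_in_open[OF open_ball, of 0 0 1]]) (use assms(1) in auto)
  from taylor_coeff_cong[OF this, of j] have "x j = taylor_coeff (\<lambda>z. 0) j"
    unfolding taylor_coeff_poly using assms(2) by simp
  then show ?thesis using taylor_coeff_poly[of "\<lambda>_. 0" 0] by simp
qed

lemma is_polyfun_poly_coeffs:
  fixes R :: "nat \<Rightarrow> complex poly"
  shows "is_polyfun (\<lambda>z1 z2. \<Sum>j\<le>m. poly (R j) z2 * z1 ^ j)"
proof -
  \<comment> \<open>\<open>is_polyfun\<close> wants one bound for both exponents; \<open>N\<close>
    dominates m and every degree.\<close>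
  define N where "N = m + (\<Sum>j\<le>m. degree (R j))"
  define d where "d = (\<lambda>j k. if j \<le> m then coeff (R j) k else 0)"
  have "poly (R j) z = (\<Sum>k\<le>N. coeff (R j) k * z ^ k)" if "j \<le> m" for j z
  proof -
    have "degree (R j) \<le> (\<Sum>j\<le>m. degree (R j))" using that by (intro member_le_sum) auto
    then show ?thesis unfolding poly_altdef
      by (intro sum.mono_neutral_left) (auto simp: N_def intro: coeff_eq_0)
  qed
  then have "(\<Sum>j\<le>m. poly (R j) z2 * z1 ^ j) = (\<Sum>j\<le>m. slice_coeff d N z2 j * z1 ^ j)" for z1 z2
    by (intro sum.cong) (auto simp: d_def slice_coeff_def)
  also have "\<dots> z1 z2 = (\<Sum>j\<le>N. slice_coeff d N z2 j * z1 ^ j)" for z1 z2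
    by (rule sum.mono_neutral_left) (auto simp: N_def d_def slice_coeff_def)
  finally show ?thesis unfolding is_polyfun_def bipoly_slice by blast
qed

text \<open>Each z1-coefficient is a polynomial in z2 with root \<open>w\<close>; the linear factor
  is divided out of all of them separately.\<close>

lemma bipoly_factor_linear:
  assumes "\<And>j. j \<le> m \<Longrightarrow> slice_coeff c n w j = 0"
  obtains r where "is_polyfun r" "\<And>z1 z2. bipoly c m n z1 z2 = (z2 - w) * r z1 z2"
proof -
  define Q where "Q = (\<lambda>j. \<Sum>k\<le>n. monom (c j k) k)"
  have Q: "poly (Q j) z = slice_coeff c n z j" for j z
    by (simp add: Q_def slice_coeff_def poly_sum poly_monom)
  have "\<exists>R. Q j = [:-w, 1:] * R" if "j \<le> m" for j
    using assms[OF that] unfolding Q[symmetric] by (simp add: poly_eq_0_iff_dvd dvd_def)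
  then obtain R where R: "\<And>j. j \<le> m \<Longrightarrow> Q j = [:-w, 1:] * R j" by metis
  show ?thesis
  proof (rule that[OF is_polyfun_poly_coeffs[of R m]])
    fix z1 z2
    have "slice_coeff c n z2 j = (z2 - w) * poly (R j) z2" if "j \<le> m" for j
      unfolding Q[symmetric] R[OF that] by (simp add: algebra_simps)
    then show "bipoly c m n z1 z2 = (z2 - w) * (\<Sum>j\<le>m. poly (R j) z2 * z1 ^ j)"
      unfolding bipoly_slice sum_distrib_left by (intro sum.cong) (auto simp: mult.assoc)
  qed
qed

text \<open>If the slice at \<open>w\<close> vanished identically, so would the slice of the
  reflection, by \<open>bipoly_refl_slice\<close>; then z2 - w would be a nonconstant common
  factor.\<close>

lemma atoral_slice_nonzero:
  assumes "atoral c m n" and w: "norm w = 1"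
  shows "\<exists>j\<le>m. slice_coeff c n w j \<noteq> 0"
proof (rule ccontr)
  assume "\<not> ?thesis"
  then have c0: "\<And>j. j \<le> m \<Longrightarrow> slice_coeff c n w j = 0" by blast
  have "slice_coeff (refl_coeff c m n) n w j = 0" if "j \<le> m" for j
  proof (rule poly_coeffs_zero_of_zero_on_disc[where m = m and x = "slice_coeff (refl_coeff c m n) n w"])
    fix z :: complex
    show "(\<Sum>j\<le>m. slice_coeff (refl_coeff c m n) n w j * z ^ j) = 0"
      using bipoly_refl_slice[OF w, of c m n z] unfolding bipoly_slice by (simp add: c0)
  qed (use that in auto)
  then obtain s where s: "is_polyfun s" "\<And>z1 z2. bipoly (refl_coeff c m n) m n z1 z2 = (z2 - w) * s z1 z2"
    using bipoly_factor_linear[of m "refl_coeff c m n" n w] by blast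
  obtain r where r: "is_polyfun r" "\<And>z1 z2. bipoly c m n z1 z2 = (z2 - w) * r z1 z2"
    using bipoly_factor_linear[of m c n w] c0 by blast
  have q: "is_polyfun (\<lambda>z1 z2. z2 - w)"
    using is_polyfun_poly_coeffs[of "\<lambda>_. [:-w, 1:]" 0] by simp
  have "\<not> (\<exists>a. \<forall>z1 z2 :: complex. z2 - w = a)"
    by (metis add_diff_cancel_right' diff_self zero_neq_one)
  then show False using assms(1) q r s unfolding atoral_def by blast
qed

lemma uniform_limit_sum:
  fixes f :: "'i \<Rightarrow> 'n \<Rightarrow> 'a \<Rightarrow> 'b::real_normed_vector"
  assumes "\<And>i. i \<in> I \<Longrightarrow> uniform_limit S (f i) (g i) F"
  shows "uniform_limit S (\<lambda>n x. \<Sum>i\<in>I. f i n x) (\<lambda>x. \<Sum>i\<in>I. g i x) F"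
  using assms
  by (induction I rule: infinite_finite_induct) (auto intro!: uniform_limit_add uniform_limit_const)

text \<open>For |w| = 1 the slice is a locally uniform limit of the zero-free slices at r w with r <
  1. By Hurwitz it is zero-free or constant, and a constant slice with a zero is excluded by
  \<open>atoral_slice_nonzero\<close>. The first variable stays in the open disc, so zeros on the
  torus remain possible.\<close>

lemma bipoly_nonzero_closed:
  assumes nz: "no_zeros_bidisc c m n" and at: "atoral c m n" and z: "norm z < 1" and w: "norm w \<le> 1"
  shows "bipoly c m n z w \<noteq> 0"
proof (cases "norm w < 1")
  case True
  then show ?thesis using nz z by (simp add: no_zeros_bidisc_def)
next
  case False
  then have w1: "norm w = 1" using w by simp
  define r where "r = (\<lambda>i. 1 - inverse (real (Suc i)))"
  have r: "r \<longlonglongrightarrow> 1"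
    unfolding r_def using tendsto_diff[OF tendsto_const LIMSEQ_inverse_real_of_nat, of 1] by simp
  have r1: "norm (of_real (r i) * w) < 1" for i
  proof -
    have "0 \<le> r i" "r i < 1" by (simp_all add: r_def inverse_le_1_iff)
    then show ?thesis by (simp add: norm_mult w1)
  qed
  have hol: "(\<lambda>z. bipoly c m n z v) holomorphic_on A" for v A
    unfolding bipoly_def by (intro holomorphic_intros)
  have "(\<lambda>z. bipoly c m n z w) constant_on ball 0 1" if z0: "bipoly c m n z w = 0"
  proof (rule ccontr)
    assume nc: "\<not> (\<lambda>z. bipoly c m n z w) constant_on ball 0 1"
    have "bipoly c m n z w \<noteq> 0"
    proof (rule Hurwitz_no_zeros[where \<F> = "\<lambda>i z. bipoly c m n z (of_real (r i) * w)" and S = "ball 0 1"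
          and g = "\<lambda>z. bipoly c m n z w" and ?z0.0 = z])
      show "(\<lambda>z. bipoly c m n z (of_real (r i) * w)) holomorphic_on ball 0 1" for i by (rule hol)
      show "(\<lambda>z. bipoly c m n z w) holomorphic_on ball 0 1" by (rule hol)
      show "bipoly c m n z (of_real (r i) * w) \<noteq> 0" if "z \<in> ball 0 1" for i z
        using nz r1[of i] that by (simp add: no_zeros_bidisc_def)
      fix K :: "complex set" assume K: "compact K" "K \<subseteq> ball 0 1"
      have bK: "bounded ((\<lambda>z. x * z ^ j) ` K)" for j and x :: complex
        by (intro compact_imp_bounded compact_continuous_image continuous_intros K)
      have b1: "bounded ((\<lambda>z. y) ` K)" for y :: complex
        by (rule bounded_subset[of "{y}"]) auto
      have lim: "(\<lambda>i. (of_real (r i) * w) ^ k) \<longlonglongrightarrow> w ^ k" for k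
        using tendsto_power[OF tendsto_mult[OF tendsto_of_real[OF r] tendsto_const[of w]], of k] by simp
      have "uniform_limit K (\<lambda>i z. (of_real (r i) * w) ^ k) (\<lambda>z. w ^ k) sequentially" for k
        using lim[of k] by (auto simp: uniform_limit_iff tendsto_iff)
      then show "uniform_limit K (\<lambda>i z. bipoly c m n z (of_real (r i) * w)) (\<lambda>z. bipoly c m n z w) sequentially"
        unfolding bipoly_def
        by (intro uniform_limit_sum uniform_lim_mult uniform_limit_const bK b1)
    qed (use nc z in auto)
    then show False using z0 by simp
  qed
  then have zero: "bipoly c m n v w = 0" if "bipoly c m n z w = 0" "norm v < 1" for v
    using that z by (auto simp: constant_on_def)
  show ?thesis
  proof
    assume "bipoly c m n z w = 0"
    from poly_coeffs_zero_of_zero_on_disc[where m = m and x = "slice_coeff c n w", folded bipoly_slice, OF zero[OF this]]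
    show False using atoral_slice_nonzero[OF at w1] by auto
  qed
qed

subsection \<open>Taylor coefficients in two variables\<close>

lemma bipoly_at_0: "bipoly c m n 0 w = slice_coeff c n w 0"
  by (simp add: bipoly_slice power_0_left if_distrib sum.delta' cong: if_cong)

lemma bipoly_swap: "bipoly (\<lambda>i k. c k i) n m w z = bipoly c m n z w"
  unfolding bipoly_def by (subst sum.swap) (simp add: mult_ac)

text \<open>The coefficient of z^k in p * (d / p) = d, with w fixed.\<close>

lemma bipoly_ratio_coeff_recursion:
  assumes nz: "slice_coeff c n w 0 \<noteq> 0"
  shows "(\<Sum>i\<le>k. (if i \<le> m then slice_coeff c n w i else 0) *
            taylor_coeff (\<lambda>z. bipoly d m n z w / bipoly c m n z w) (k - i)) =
         (if k \<le> m then slice_coeff d n w k else 0)"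
proof -
  have an: "(\<lambda>z. bipoly e m n z w) analytic_on {0}" for e
    unfolding bipoly_def by (intro analytic_intros)
  have an2: "(\<lambda>z. bipoly d m n z w / bipoly c m n z w) analytic_on {0}"
    by (rule analytic_on_divide[OF an an]) (use nz in \<open>simp add: bipoly_at_0\<close>)
  have "eventually (\<lambda>z. bipoly c m n z w \<noteq> 0) (nhds 0)"
  proof -
    have "open {z. bipoly c m n z w \<noteq> 0}" unfolding bipoly_def by (intro open_Collect_neq continuous_intros)
    from eventually_nhds_in_open[OF this, of 0] show ?thesis using nz by (simp add: bipoly_at_0)
  qed
  then have "eventually (\<lambda>z. bipoly c m n z w * (bipoly d m n z w / bipoly c m n z w) = bipoly d m n z w) (nhds 0)"
    by eventually_elim simp
  from taylor_coeff_cong[OF this, of k]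
  have "(\<Sum>i\<le>k. taylor_coeff (\<lambda>z. bipoly c m n z w) i * taylor_coeff (\<lambda>z. bipoly d m n z w / bipoly c m n z w) (k - i)) =
      taylor_coeff (\<lambda>z. bipoly d m n z w) k"
    unfolding taylor_coeff_mult[OF an[of c] an2] .
  moreover have "taylor_coeff (\<lambda>z. bipoly e m n z w) i = (if i \<le> m then slice_coeff e n w i else 0)" for e i
    unfolding bipoly_slice by (rule taylor_coeff_poly)
  ultimately show ?thesis by (simp only:)
qed

lemma slice_coeff_holomorphic: "(\<lambda>w. slice_coeff c n w j) holomorphic_on A"
  unfolding slice_coeff_def by (intro holomorphic_intros)

lemma open_slice_coeff_nonzero: "open {w. slice_coeff c n w j \<noteq> 0}"
  unfolding slice_coeff_def by (intro open_Collect_neq continuous_intros)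

text \<open>Solving the recursion for the top coefficient divides only by p(0, w). The coefficients
  are therefore holomorphic wherever p(0, w) is nonzero, whatever other zeros p(., w) has.\<close>

lemma bipoly_ratio_coeff_holomorphic:
  "(\<lambda>w. taylor_coeff (\<lambda>z. bipoly d m n z w / bipoly c m n z w) k) holomorphic_on {w. slice_coeff c n w 0 \<noteq> 0}"
proof (induction k rule: less_induct)
  case (less k)
  define a where "a = (\<lambda>k w. taylor_coeff (\<lambda>z. bipoly d m n z w / bipoly c m n z w) k)"
  define A where "A = (\<lambda>i w. if i \<le> m then slice_coeff c n w i else 0)"
  have hA: "A i holomorphic_on S" for i S
    by (cases "i \<le> m") (simp_all add: A_def slice_coeff_holomorphic)
  have hD: "(\<lambda>w. if k \<le> m then slice_coeff d n w k else 0) holomorphic_on S" for S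
    by (cases "k \<le> m") (simp_all add: slice_coeff_holomorphic)
  have h1: "a k w = ((if k \<le> m then slice_coeff d n w k else 0) - (\<Sum>i\<in>{..k} - {0}. A i w * a (k - i) w)) / slice_coeff c n w 0"
    if "slice_coeff c n w 0 \<noteq> 0" for w
  proof -
    have "(\<Sum>i\<le>k. A i w * a (k - i) w) = (if k \<le> m then slice_coeff d n w k else 0)"
      unfolding A_def a_def by (rule bipoly_ratio_coeff_recursion[OF that])
    moreover have "(\<Sum>i\<le>k. A i w * a (k - i) w) = A 0 w * a k w + (\<Sum>i\<in>{..k} - {0}. A i w * a (k - i) w)"
      by (subst sum.remove[of _ 0]) auto
    ultimately show ?thesis using that by (simp add: A_def field_simps)
  qed
  have h2: "(\<lambda>w. ((if k \<le> m then slice_coeff d n w k else 0) - (\<Sum>i\<in>{..k} - {0}. A i w * a (k - i) w)) / slice_coeff c n w 0)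
      holomorphic_on {w. slice_coeff c n w 0 \<noteq> 0}"
    using less by (intro holomorphic_intros hD hA slice_coeff_holomorphic) (auto simp: a_def)
  have "a k holomorphic_on {w. slice_coeff c n w 0 \<noteq> 0}"
    by (rule holomorphic_transform[OF h2], rule h1[symmetric]) simp
  then show ?case by (simp only: a_def)
qed

lemma bipoly_ratio_coeff_analytic_0:
  assumes "c 0 0 \<noteq> 0"
  shows "(\<lambda>w. taylor_coeff (\<lambda>z. bipoly d m n z w / bipoly c m n z w) k) analytic_on {0}"
proof -
  have "slice_coeff c n 0 0 \<noteq> 0"
    using assms by (simp add: slice_coeff_def power_0_left if_distrib sum.delta' cong: if_cong)
  then show ?thesis
    unfolding analytic_at
    by (intro exI[of _ "{w. slice_coeff c n w 0 \<noteq> 0}"] conjI open_slice_coeff_nonzero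
        bipoly_ratio_coeff_holomorphic) simp
qed

text \<open>Extracting the w-coefficient from the one-variable recursion yields a two-dimensional
  convolution equation, which determines the coefficients once c 0 0 is nonzero.\<close>

lemma bipoly_ratio_double_recursion:
  fixes c d :: "nat \<Rightarrow> nat \<Rightarrow> complex"
  assumes c: "c 0 0 \<noteq> 0"
  shows "(\<Sum>i\<le>k. \<Sum>h\<le>l. (if i \<le> m \<and> h \<le> n then c i h else 0) *
            taylor_coeff (\<lambda>w. taylor_coeff (\<lambda>z. bipoly d m n z w / bipoly c m n z w) (k - i)) (l - h)) =
         (if k \<le> m \<and> l \<le> n then d k l else 0)"
proof -
  define a where "a = (\<lambda>k w. taylor_coeff (\<lambda>z. bipoly d m n z w / bipoly c m n z w) k)"
  have an: "a k analytic_on {0}" for k unfolding a_def by (rule bipoly_ratio_coeff_analytic_0) (rule c)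
  define A where "A = (\<lambda>e i w. if i \<le> m then slice_coeff e n w i else 0)"
  have anA: "A e i analytic_on {0}" for e i
    by (cases "i \<le> m") (auto simp: A_def slice_coeff_def intro!: analytic_intros)
  have tA: "taylor_coeff (A e i) h = (if i \<le> m \<and> h \<le> n then e i h else 0)" for e i h
    using taylor_coeff_poly[of "e i" n h] taylor_coeff_poly[of "\<lambda>_. 0" 0 h]
    by (cases "i \<le> m") (simp_all add: A_def slice_coeff_def)
  have "slice_coeff c n 0 0 \<noteq> 0"
    using c by (simp add: slice_coeff_def power_0_left if_distrib sum.delta' cong: if_cong)
  then have "eventually (\<lambda>w. slice_coeff c n w 0 \<noteq> 0) (nhds 0)"
    using eventually_nhds_in_open[OF open_slice_coeff_nonzero, of 0] by simp
  then have "eventually (\<lambda>w. (\<Sum>i\<le>k. A c i w * a (k - i) w) = A d k w) (nhds 0)"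
    by eventually_elim (unfold A_def a_def, rule bipoly_ratio_coeff_recursion)
  from taylor_coeff_cong[OF this, of l]
  have "(\<Sum>i\<le>k. taylor_coeff (\<lambda>w. A c i w * a (k - i) w) l) = taylor_coeff (A d k) l"
    by (subst (asm) taylor_coeff_sum) (auto intro!: analytic_on_mult an anA)
  then show ?thesis
    unfolding taylor_coeff_mult[OF anA an] tA by (simp add: a_def)
qed

lemma double_recursion_unique:
  fixes c X Y :: "nat \<Rightarrow> nat \<Rightarrow> 'a::idom"
  assumes "c 0 0 \<noteq> 0"
    and eq: "\<And>k l. (\<Sum>i\<le>k. \<Sum>h\<le>l. c i h * X (k - i) (l - h)) = (\<Sum>i\<le>k. \<Sum>h\<le>l. c i h * Y (k - i) (l - h))"
  shows "X k l = Y k l"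
proof (induction "k + l" arbitrary: k l rule: less_induct)
  case less
  have *: "(\<Sum>i\<le>k. \<Sum>h\<le>l. c i h * Z (k - i) (l - h)) = c 0 0 * Z k l +
       (\<Sum>(i, h)\<in>{..k} \<times> {..l} - {(0, 0)}. c i h * Z (k - i) (l - h))" for Z :: "nat \<Rightarrow> nat \<Rightarrow> 'a"
    unfolding sum.cartesian_product by (subst sum.remove[of "{..k} \<times> {..l}" "(0, 0)"]) simp_all
  have "(\<Sum>(i, h)\<in>{..k} \<times> {..l} - {(0, 0)}. c i h * X (k - i) (l - h)) =
      (\<Sum>(i, h)\<in>{..k} \<times> {..l} - {(0, 0)}. c i h * Y (k - i) (l - h))"
  proof (rule sum.cong[OF refl])
    fix x assume x: "x \<in> {..k} \<times> {..l} - {(0, 0)}"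
    obtain i h where [simp]: "x = (i, h)" by fastforce
    from x have "(k - i) + (l - h) < k + l" by auto
    from less[OF this] show "(case x of (i, h) \<Rightarrow> c i h * X (k - i) (l - h)) = (case x of (i, h) \<Rightarrow> c i h * Y (k - i) (l - h))"
      by simp
  qed
  then have "c 0 0 * X k l = c 0 0 * Y k l"
    using eq[of k l, unfolded *[of X] *[of Y]] by (simp only: add_right_cancel)
  then show ?case using assms(1) by simp
qed

text \<open>\<open>taylor2\<close> differentiates in z2 first, while the slice argument expands in
  z1 first and applies Parseval in z2. Both orders satisfy the same convolution equation and so
  agree, without any theorem on mixed partial derivatives.\<close>

lemma taylor2_bipoly_ratio:
  fixes c d :: "nat \<Rightarrow> nat \<Rightarrow> complex" and m n :: nat
  assumes c: "c 0 0 \<noteq> 0"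
  defines "f \<equiv> (\<lambda>z w. bipoly d m n z w / bipoly c m n z w)"
  shows "taylor2 f k l = taylor_coeff (\<lambda>z. taylor_coeff (\<lambda>w. f z w) l) k"
    and "taylor2 f k l = taylor_coeff (\<lambda>w. taylor_coeff (\<lambda>z. f z w) k) l"
proof -
  \<comment> \<open>Transposed coefficients, so that the results on z1-coefficients also apply when
    z2 is expanded first.\<close>
  define c' d' where "c' = (\<lambda>i k. c k i)" and "d' = (\<lambda>i k. d k i)"
  have c': "c' 0 0 \<noteq> 0" using c by (simp add: c'_def)
  have f': "f z w = bipoly d' n m w z / bipoly c' n m w z" for z w
    unfolding f_def c'_def d'_def by (simp only: bipoly_swap[of c n m w z] bipoly_swap[of d n m w z])
  have an: "(\<lambda>z. taylor_coeff (\<lambda>w. f z w) l) analytic_on {0}"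
    unfolding f' by (rule bipoly_ratio_coeff_analytic_0) (rule c')
  have E: "(deriv ^^ l) (\<lambda>w. f z w) 0 = fact l * taylor_coeff (\<lambda>w. f z w) l" for z
    unfolding taylor_coeff_def by simp
  have "(deriv ^^ k) (\<lambda>z. (deriv ^^ l) (\<lambda>w. f z w) 0) 0 = fact l * (deriv ^^ k) (\<lambda>z. taylor_coeff (\<lambda>w. f z w) l) 0"
    unfolding E by (rule higher_deriv_cmult'[OF an])
  then show 1: "taylor2 f k l = taylor_coeff (\<lambda>z. taylor_coeff (\<lambda>w. f z w) l) k"
    unfolding taylor2_def taylor_coeff_def[of _ k] by (simp only: mult.commute[of "fact k"]) simp
  define X where "X = (\<lambda>k l. taylor_coeff (\<lambda>z. taylor_coeff (\<lambda>w. f z w) l) k)"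
  define Y where "Y = (\<lambda>k l. taylor_coeff (\<lambda>w. taylor_coeff (\<lambda>z. f z w) k) l)"
  have "X k l = Y k l"
  proof (rule double_recursion_unique[where c = "\<lambda>i h. if i \<le> m \<and> h \<le> n then c i h else 0"])
    fix k l
    have Y: "(\<Sum>i\<le>k. \<Sum>h\<le>l. (if i \<le> m \<and> h \<le> n then c i h else 0) * Y (k - i) (l - h)) =
         (if k \<le> m \<and> l \<le> n then d k l else 0)"
      unfolding Y_def f_def by (rule bipoly_ratio_double_recursion) (rule c)
    have X: "(\<Sum>h\<le>l. \<Sum>i\<le>k. (if h \<le> n \<and> i \<le> m then c' h i else 0) * X (k - i) (l - h)) =
         (if l \<le> n \<and> k \<le> m then d' l k else 0)"
      unfolding X_def f' by (rule bipoly_ratio_double_recursion) (rule c')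
    have "(\<Sum>i\<le>k. \<Sum>h\<le>l. (if i \<le> m \<and> h \<le> n then c i h else 0) * X (k - i) (l - h)) =
        (\<Sum>h\<le>l. \<Sum>i\<le>k. (if h \<le> n \<and> i \<le> m then c' h i else 0) * X (k - i) (l - h))"
      by (subst sum.swap, intro sum.cong refl arg_cong2[where f = times]) (auto simp: c'_def)
    then show "(\<Sum>i\<le>k. \<Sum>h\<le>l. (if i \<le> m \<and> h \<le> n then c i h else 0) * X (k - i) (l - h)) =
        (\<Sum>i\<le>k. \<Sum>h\<le>l. (if i \<le> m \<and> h \<le> n then c i h else 0) * Y (k - i) (l - h))"
      unfolding X Y by (auto simp: d'_def)
  qed (simp add: c)
  then show "taylor2 f k l = taylor_coeff (\<lambda>w. taylor_coeff (\<lambda>z. f z w) k) l"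
    unfolding 1 X_def Y_def .
qed

subsection \<open>Boundary values\<close>

definition bipoly_dz :: "(nat \<Rightarrow> nat \<Rightarrow> complex) \<Rightarrow> nat \<Rightarrow> nat \<Rightarrow> complex \<Rightarrow> complex \<Rightarrow> complex" where
  "bipoly_dz c m n z w = (\<Sum>j\<le>m. \<Sum>k\<le>n. c j k * (of_nat j * z ^ (j - 1)) * w ^ k)"

text \<open>The quotient rule written out; unlike \<open>d1\<close> it is visibly continuous
  wherever the denominator is nonzero, on the torus too.\<close>

definition ratio_dz :: "(nat \<Rightarrow> nat \<Rightarrow> complex) \<Rightarrow> (nat \<Rightarrow> nat \<Rightarrow> complex) \<Rightarrow> nat \<Rightarrow> nat \<Rightarrow> complex \<Rightarrow> complex \<Rightarrow> complex" where
  "ratio_dz d c m n z w =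
     (bipoly_dz d m n z w * bipoly c m n z w - bipoly d m n z w * bipoly_dz c m n z w) / (bipoly c m n z w)\<^sup>2"

lemma bipoly_has_derivative: "((\<lambda>z. bipoly c m n z w) has_field_derivative bipoly_dz c m n z w) (at z)"
  unfolding bipoly_def bipoly_dz_def by (auto intro!: derivative_eq_intros sum.cong)

lemma d1_ratio:
  assumes "bipoly c m n z w \<noteq> 0"
  shows "d1 (\<lambda>z w. bipoly d m n z w / bipoly c m n z w) z w = ratio_dz d c m n z w"
  unfolding d1_def ratio_dz_def power2_eq_square
  by (rule DERIV_imp_deriv[OF DERIV_divide[OF bipoly_has_derivative bipoly_has_derivative assms]])

lemma continuous_on_bipoly [continuous_intros]:
  assumes "continuous_on S f" "continuous_on S g"
  shows "continuous_on S (\<lambda>x. bipoly c m n (f x) (g x))" "continuous_on S (\<lambda>x. bipoly_dz c m n (f x) (g x))"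
  unfolding bipoly_def bipoly_dz_def by (intro continuous_intros assms)+

lemma continuous_on_ratio_dz:
  assumes "continuous_on S f" "continuous_on S g" "\<And>x. x \<in> S \<Longrightarrow> bipoly c m n (f x) (g x) \<noteq> 0"
  shows "continuous_on S (\<lambda>x. ratio_dz d c m n (f x) (g x))"
  unfolding ratio_dz_def using assms by (intro continuous_intros) auto

lemma continuous_on_d1_torus:
  fixes c d :: "nat \<Rightarrow> nat \<Rightarrow> complex" and m n :: nat and r P :: real
  assumes nz: "no_zeros_bidisc c m n" and r: "0 < r" "r < 1" and P: "0 < P"
  defines "f \<equiv> (\<lambda>z w. bipoly d m n z w / bipoly c m n z w)"
  shows "continuous_on UNIV (\<lambda>(s, t). norm (d1 f (of_real r * cis s) (of_real r * cis t)) powr P)"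
proof -
  have nz': "bipoly c m n (of_real r * cis s) (of_real r * cis t) \<noteq> 0" for s t
    using nz r by (simp add: no_zeros_bidisc_def norm_mult)
  have "continuous_on UNIV (\<lambda>x. norm (ratio_dz d c m n (of_real r * cis (fst x)) (of_real r * cis (snd x))) powr P)"
    by (rule continuous_on_powr'[OF continuous_on_norm[OF continuous_on_ratio_dz] continuous_on_const])
       (use nz' P in \<open>auto intro!: continuous_intros\<close>)
  moreover have "d1 f (of_real r * cis s) (of_real r * cis t) = ratio_dz d c m n (of_real r * cis s) (of_real r * cis t)" for s t
    unfolding f_def by (rule d1_ratio[OF nz'])
  ultimately show ?thesis unfolding case_prod_unfold by (simp only:)
qed

text \<open>Passes from the signed integrals of the Hardy condition to nonnegative ones, where Fatou
  and Tonelli ask only for measurability.\<close>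

lemma iterated_nn_integral_eq_LBINT:
  fixes F :: "real \<Rightarrow> real \<Rightarrow> real"
  assumes F: "continuous_on UNIV (\<lambda>(s, t). F s t)" and nn: "\<And>s t. 0 \<le> F s t" and ab: "a \<le> b"
  shows "(\<integral>\<^sup>+s\<in>{a..b}. (\<integral>\<^sup>+t\<in>{a..b}. ennreal (F s t) \<partial>lborel) \<partial>lborel) =
    ennreal (LBINT s=ereal a..ereal b. (LBINT t=ereal a..ereal b. F s t))"
proof -
  have Fs: "continuous_on A (F s)" for s A
    using continuous_on_compose2[OF F, of A "\<lambda>t. (s, t)"] by (simp add: continuous_intros)
  have inner: "(LBINT t=ereal a..ereal b. F s t) = integral {a..b} (F s)" for s
    using ab by (intro interval_integral_eq_integral borel_integrable_atLeastAtMost' Fs)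
  have nn2: "0 \<le> integral {a..b} (F s)" for s
    by (intro integral_nonneg integrable_continuous_interval Fs nn)
  have cI: "continuous_on {a..b} (\<lambda>s. integral {a..b} (F s))"
    using integral_continuous_on_param[of "{a..b}" a b F] continuous_on_subset[OF F, of "{a..b} \<times> {a..b}"] by simp
  have "(\<integral>\<^sup>+t\<in>{a..b}. ennreal (F s t) \<partial>lborel) = ennreal (integral {a..b} (F s))" for s
    by (rule nn_integral_has_integral_lebesgue') (auto intro!: nn integrable_integral integrable_continuous_interval Fs)
  moreover have "(\<integral>\<^sup>+s\<in>{a..b}. ennreal (integral {a..b} (F s)) \<partial>lborel) = ennreal (integral {a..b} (\<lambda>s. integral {a..b} (F s)))"
    by (rule nn_integral_has_integral_lebesgue') (auto intro!: nn2 integrable_integral integrable_continuous_interval cI)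
  moreover have "(LBINT s=ereal a..ereal b. integral {a..b} (F s)) = integral {a..b} (\<lambda>s. integral {a..b} (F s))"
    using ab by (intro interval_integral_eq_integral borel_integrable_atLeastAtMost' cI)
  ultimately show ?thesis by (simp only: inner)
qed

text \<open>The limit inferior carries the bound on the tori of radius \<open>r < 1\<close> to the distinguished boundary,
  where the derivative itself is undefined at the zeros of the denominator.\<close>
lemma boundary_derivative_majorant:
  fixes c d :: "nat \<Rightarrow> nat \<Rightarrow> complex" and m n :: nat and P M :: real
  assumes nz: "no_zeros_bidisc c m n" and P: "0 < P"
  defines "f \<equiv> (\<lambda>z w. bipoly d m n z w / bipoly c m n z w)"
  assumes M: "\<And>r. 0 < r \<Longrightarrow> r < 1 \<Longrightarrow> (\<integral>\<^sup>+t\<in>{0..2*pi}. (\<integral>\<^sup>+s\<in>{0..2*pi}.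
      ennreal (norm (d1 f (of_real r * cis s) (of_real r * cis t)) powr P) \<partial>lborel) \<partial>lborel) \<le> ennreal M"
  obtains g :: "real \<Rightarrow> real \<Rightarrow> ennreal" where
    "(\<lambda>t. \<integral>\<^sup>+s\<in>{0..2*pi}. g t s \<partial>lborel) \<in> borel_measurable lborel"
    "(\<integral>\<^sup>+t\<in>{0..2*pi}. (\<integral>\<^sup>+s\<in>{0..2*pi}. g t s \<partial>lborel) \<partial>lborel) \<le> ennreal M"
    "\<And>s t. s \<in> {0..2*pi} \<Longrightarrow> t \<in> {0..2*pi} \<Longrightarrow> bipoly c m n (cis s) (cis t) \<noteq> 0 \<Longrightarrow>
       ennreal (norm (deriv (\<lambda>z. f z (cis t)) (cis s)) powr P) \<le> g t s"
proof -
  define I where "I = {0..2*pi}"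
  \<comment> \<open>The double \<open>Suc\<close> starts the sequence at 1/2 instead of 0, since the
    bound \<open>M\<close> is available only for positive radii.\<close>
  define r where "r = (\<lambda>i. 1 - inverse (real (Suc (Suc i))))"
  have r01: "0 < r i" "r i < 1" for i by (simp_all add: r_def inverse_less_1_iff)
  have "(\<lambda>i. inverse (real (Suc (Suc i)))) \<longlonglongrightarrow> 0"
    using LIMSEQ_Suc[OF LIMSEQ_inverse_real_of_nat] by simp
  then have r: "r \<longlonglongrightarrow> 1"
    unfolding r_def using tendsto_diff[OF tendsto_const, of _ 0 sequentially 1] by simp
  define F where "F = (\<lambda>i t s. norm (d1 f (of_real (r i) * cis s) (of_real (r i) * cis t)) powr P)"
  define u where "u = (\<lambda>i (x :: real \<times> real). ennreal (F i (fst x) (snd x)) * indicator (I \<times> I) x)"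
  have cF: "continuous_on UNIV (\<lambda>x. F i (fst x) (snd x))" for i
    using continuous_on_compose2[OF continuous_on_d1_torus[OF nz r01(1)[of i] r01(2)[of i] P, of d, folded f_def], of UNIV "\<lambda>x. (snd x, fst x)"]
    by (simp add: F_def continuous_intros)
  have mu: "u i \<in> borel_measurable (lborel \<Otimes>\<^sub>M lborel)" for i
  proof -
    have "(\<lambda>x. F i (fst x) (snd x)) \<in> borel_measurable borel"
      by (rule borel_measurable_continuous_onI[OF cF])
    moreover have "I \<times> I \<in> sets borel" by (intro borel_closed closed_Times) (auto simp: I_def)
    ultimately show ?thesis unfolding u_def lborel_prod by measurable
  qed
  \<comment> \<open>Fatou bounds the integral of this lower limit; where the denominator is nonzero
    it is a true limit, namely the boundary value of the derivative.\<close>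
  define g where "g = (\<lambda>t s. liminf (\<lambda>i. u i (t, s)))"
  have mg: "(\<lambda>x. g (fst x) (snd x)) \<in> borel_measurable (lborel \<Otimes>\<^sub>M lborel)"
    unfolding g_def prod.collapse by (intro borel_measurable_liminf mu)
  have mgI: "(\<lambda>x. g (fst x) (snd x) * indicator {0..2*pi} (snd x)) \<in> borel_measurable (lborel \<Otimes>\<^sub>M lborel)"
    by (intro borel_measurable_times_ennreal mg) measurable
  show ?thesis
  proof (rule that[of g])
    show "(\<lambda>t. \<integral>\<^sup>+s\<in>{0..2*pi}. g t s \<partial>lborel) \<in> borel_measurable lborel"
      by (rule lborel.borel_measurable_nn_integral) (unfold case_prod_unfold, rule mgI)
    have "(\<integral>\<^sup>+t\<in>{0..2*pi}. (\<integral>\<^sup>+s\<in>{0..2*pi}. g t s \<partial>lborel) \<partial>lborel) \<le> (\<integral>\<^sup>+t. (\<integral>\<^sup>+s. g t s \<partial>lborel) \<partial>lborel)"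
    proof (rule nn_integral_mono)
      have le: "y * indicator A x \<le> y" for y :: ennreal and A and x :: real
        by (simp split: split_indicator)
      fix t
      show "(\<integral>\<^sup>+s\<in>{0..2*pi}. g t s \<partial>lborel) * indicator {0..2*pi} t \<le> (\<integral>\<^sup>+s. g t s \<partial>lborel)"
        by (rule order_trans[OF le nn_integral_mono[OF le]])
    qed
    also have "\<dots> = (\<integral>\<^sup>+x. g (fst x) (snd x) \<partial>(lborel \<Otimes>\<^sub>M lborel))"
      using lborel.nn_integral_fst[OF mg] by simp
    also have "\<dots> = (\<integral>\<^sup>+x. liminf (\<lambda>i. u i x) \<partial>(lborel \<Otimes>\<^sub>M lborel))"
      by (simp add: g_def)
    also have "\<dots> \<le> liminf (\<lambda>i. \<integral>\<^sup>+x. u i x \<partial>(lborel \<Otimes>\<^sub>M lborel))"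
      by (rule nn_integral_liminf[OF mu])
    also have "\<dots> \<le> ennreal M"
    proof (rule Liminf_le)
      show "\<forall>\<^sub>F i in sequentially. (\<integral>\<^sup>+x. u i x \<partial>(lborel \<Otimes>\<^sub>M lborel)) \<le> ennreal M"
      proof (rule always_eventually, rule allI)
        fix i
        have "(\<integral>\<^sup>+x. u i x \<partial>(lborel \<Otimes>\<^sub>M lborel)) = (\<integral>\<^sup>+t. (\<integral>\<^sup>+s. u i (t, s) \<partial>lborel) \<partial>lborel)"
          by (rule lborel.nn_integral_fst[OF mu, symmetric])
        also have "\<dots> = (\<integral>\<^sup>+t\<in>I. (\<integral>\<^sup>+s\<in>I. ennreal (F i t s) \<partial>lborel) \<partial>lborel)"
          by (intro nn_integral_cong) (auto simp: u_def indicator_times split: split_indicator intro!: nn_integral_cong)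
        also have "\<dots> \<le> ennreal M" unfolding I_def F_def by (rule M[OF r01])
        finally show "(\<integral>\<^sup>+x. u i x \<partial>(lborel \<Otimes>\<^sub>M lborel)) \<le> ennreal M" .
      qed
    qed simp
    finally show "(\<integral>\<^sup>+t\<in>{0..2*pi}. (\<integral>\<^sup>+s\<in>{0..2*pi}. g t s \<partial>lborel) \<partial>lborel) \<le> ennreal M" .
  next
    fix s t assume st: "s \<in> {0..2*pi}" "t \<in> {0..2*pi}" and nz1: "bipoly c m n (cis s) (cis t) \<noteq> 0"
    define D where "D = (\<lambda>\<rho>. ratio_dz d c m n (of_real \<rho> * cis s) (of_real \<rho> * cis t))"
    have d1D: "d1 f (of_real (r i) * cis s) (of_real (r i) * cis t) = D (r i)" for i
      unfolding D_def f_def using nz r01[of i] by (intro d1_ratio) (simp add: no_zeros_bidisc_def norm_mult)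
    have op: "open {\<rho>::real. bipoly c m n (of_real \<rho> * cis s) (of_real \<rho> * cis t) \<noteq> 0}"
      by (intro open_Collect_neq continuous_intros)
    have "continuous_on {\<rho>::real. bipoly c m n (of_real \<rho> * cis s) (of_real \<rho> * cis t) \<noteq> 0} D"
      unfolding D_def by (rule continuous_on_ratio_dz) (auto intro!: continuous_intros)
    then have "isCont D 1" using op nz1 by (simp add: continuous_on_eq_continuous_at)
    then have "(\<lambda>i. D (r i)) \<longlonglongrightarrow> D 1" using r by (rule isCont_tendsto_compose)
    then have "(\<lambda>i. ennreal (norm (D (r i)) powr P)) \<longlonglongrightarrow> ennreal (norm (D 1) powr P)"
      using P by (intro tendsto_ennrealI tendsto_powr' tendsto_norm tendsto_const) auto
    then have "(\<lambda>i. u i (t, s)) \<longlonglongrightarrow> ennreal (norm (D 1) powr P)"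
      using st by (simp add: u_def F_def d1D I_def)
    then have "g t s = ennreal (norm (D 1) powr P)"
      unfolding g_def by (intro lim_imp_Liminf) auto
    moreover have "deriv (\<lambda>z. f z (cis t)) (cis s) = D 1"
      using d1_ratio[OF nz1, of d] by (simp add: D_def d1_def f_def)
    ultimately show "ennreal (norm (deriv (\<lambda>z. f z (cis t)) (cis s)) powr P) \<le> g t s" by simp
  qed
qed

subsection \<open>The main estimate\<close>

lemma holo_bidisc_bipoly_ratio:
  assumes "no_zeros_bidisc c m n"
  shows "holo_bidisc (\<lambda>z w. bipoly d m n z w / bipoly c m n z w)"
proof -
  have nz: "bipoly c m n z w \<noteq> 0" if "norm z < 1" "norm w < 1" for z w
    using assms that by (simp add: no_zeros_bidisc_def)
  have h1: "(\<lambda>z. bipoly e m n z w) holomorphic_on A" for e w A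
    unfolding bipoly_def by (intro holomorphic_intros)
  have h2: "(\<lambda>w. bipoly e m n z w) holomorphic_on A" for e z A
    unfolding bipoly_def by (intro holomorphic_intros)
  show ?thesis unfolding holo_bidisc_def case_prod_unfold
    by (intro conjI ballI continuous_intros holomorphic_on_divide h1 h2) (auto simp: nz)
qed

lemma parseval_partial_sum_le:
  assumes f: "f holomorphic_on ball 0 \<rho>" and rho: "1 < \<rho>"
  shows "2 * pi * (\<Sum>l<L. (norm (taylor_coeff f l))\<^sup>2) \<le> integral {0..2*pi} (\<lambda>t. (norm (f (cis t)))\<^sup>2)"
    and "continuous_on UNIV (\<lambda>t. f (cis t))"
proof -
  have sm: "summable (\<lambda>k. norm (taylor_coeff f k))"
    using taylor_coeff_circle_sums(1)[OF f, of 1] rho by simp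
  have F: "(\<lambda>k. taylor_coeff f k * cis (real k * t)) sums f (cis t)" for t
    using taylor_coeff_circle_sums(2)[OF f, of 1 t] rho by simp
  show cont: "continuous_on UNIV (\<lambda>t. f (cis t))"
    by (rule fourier_series_integral_sums(2)[OF sm F, of "\<lambda>_. 0"]) simp
  have "(\<lambda>k. 2 * pi * (taylor_coeff f k * cnj (taylor_coeff f k))) sums integral {0..2*pi} (\<lambda>t. f (cis t) * cnj (f (cis t)))"
    by (rule parseval_sums[OF sm sm F F])
  moreover have "integral {0..2*pi} (\<lambda>t. f (cis t) * cnj (f (cis t))) = of_real (integral {0..2*pi} (\<lambda>t. (norm (f (cis t)))\<^sup>2))"
    unfolding complex_norm_square[symmetric]
    by (intro integral_unique has_integral_of_real integrable_integral integrable_continuous_interval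
        continuous_intros continuous_on_subset[OF cont] subset_UNIV)
  ultimately have "(\<lambda>k. complex_of_real (2 * pi * (norm (taylor_coeff f k))\<^sup>2)) sums of_real (integral {0..2*pi} (\<lambda>t. (norm (f (cis t)))\<^sup>2))"
    unfolding complex_norm_square[symmetric] by simp
  then have S: "(\<lambda>k. 2 * pi * (norm (taylor_coeff f k))\<^sup>2) sums integral {0..2*pi} (\<lambda>t. (norm (f (cis t)))\<^sup>2)"
    by (simp only: sums_of_real_iff)
  show "2 * pi * (\<Sum>l<L. (norm (taylor_coeff f l))\<^sup>2) \<le> integral {0..2*pi} (\<lambda>t. (norm (f (cis t)))\<^sup>2)"
    using sum_le_suminf[OF sums_summable[OF S], of "{..<L}"] unfolding sums_unique[OF S, symmetric] sum_distrib_left by simp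
qed

text \<open>Compactness gives a uniform margin \<open>e\<close>; a point of norm between r and r + e
  lies within \<open>e\<close> of its radial projection to the sphere.\<close>

lemma cball_subset_open_imp_larger_ball:
  fixes U :: "complex set"
  assumes r: "0 < r" and U: "open U" "cball 0 r \<subseteq> U"
  shows "\<exists>\<rho>>r. ball 0 \<rho> \<subseteq> U"
proof -
  obtain e where e: "e > 0" "(\<Union>x\<in>cball 0 r. cball x e) \<subseteq> U"
    by (rule compact_subset_open_imp_cball_epsilon_subset[OF compact_cball U])
  have "w \<in> U" if w: "norm w < r + e" for w
  proof (cases "norm w \<le> r")
    case True
    then show ?thesis using U by auto
  next
    case False
    define x where "x = of_real (r / norm w) * w"
    have w0: "norm w > 0" using False r by linarith
    have x: "norm x = r" using w0 r by (simp add: x_def norm_mult norm_divide)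
    have "x - w = of_real (r / norm w - 1) * w" by (simp add: x_def algebra_simps)
    then have "dist x w = \<bar>r / norm w - 1\<bar> * norm w" by (simp only: dist_norm norm_mult norm_of_real)
    also have "\<dots> = \<bar>(r / norm w - 1) * norm w\<bar>" by (simp add: abs_mult)
    also have "(r / norm w - 1) * norm w = r - norm w" using w0 by (simp add: left_diff_distrib)
    finally have "dist x w \<le> e" using False w by simp
    then have "w \<in> (\<Union>x\<in>cball 0 r. cball x e)" using x by (intro UN_I[of x]) auto
    then show ?thesis using e(2) by blast
  qed
  then have "ball 0 (r + e) \<subseteq> U" by auto
  then show ?thesis using e(1) by (intro exI[of _ "r + e"]) simp
qed

text \<open>The slice estimate at \<open>cis t\<close> is integrated over t, and Parseval turns the
  mean of |a_k(cis t)|^2 into the sum over l of |a_kl|^2. Only finite sums in k and l occur, so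
  nothing infinite has to be interchanged. The t-integral is outermost because t labels the
  slice.\<close>

lemma dirichlet2_of_d1_bound:
  fixes c :: "nat \<Rightarrow> nat \<Rightarrow> complex" and m n :: nat and P M :: real
  assumes nz: "no_zeros_bidisc c m n" and at: "atoral c m n" and P: "0 < P"
  defines "\<phi> \<equiv> (\<lambda>z w. bipoly (refl_coeff c m n) m n z w / bipoly c m n z w)"
  assumes M: "\<And>r. 0 < r \<Longrightarrow> r < 1 \<Longrightarrow> (\<integral>\<^sup>+t\<in>{0..2*pi}. (\<integral>\<^sup>+s\<in>{0..2*pi}.
      ennreal (norm (d1 \<phi> (of_real r * cis s) (of_real r * cis t)) powr P) \<partial>lborel) \<partial>lborel) \<le> ennreal M"
  shows "dirichlet2 P 0 \<phi>"
proof -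
  define I where "I = {0..2*pi}"
  obtain g where g: "(\<lambda>t. \<integral>\<^sup>+s\<in>I. g t s \<partial>lborel) \<in> borel_measurable lborel"
    "(\<integral>\<^sup>+t\<in>I. (\<integral>\<^sup>+s\<in>I. g t s \<partial>lborel) \<partial>lborel) \<le> ennreal M"
    "\<And>s t. s \<in> I \<Longrightarrow> t \<in> I \<Longrightarrow> bipoly c m n (cis s) (cis t) \<noteq> 0 \<Longrightarrow>
       ennreal (norm (deriv (\<lambda>z. \<phi> z (cis t)) (cis s)) powr P) \<le> g t s"
  proof (rule boundary_derivative_majorant[OF nz P M[unfolded \<phi>_def]])
    fix g
    assume "(\<lambda>t. \<integral>\<^sup>+s\<in>{0..2*pi}. g t s \<partial>lborel) \<in> borel_measurable lborel"
      "(\<integral>\<^sup>+t\<in>{0..2*pi}. (\<integral>\<^sup>+s\<in>{0..2*pi}. g t s \<partial>lborel) \<partial>lborel) \<le> ennreal M"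
      "\<And>s t. s \<in> {0..2*pi} \<Longrightarrow> t \<in> {0..2*pi} \<Longrightarrow> bipoly c m n (cis s) (cis t) \<noteq> 0 \<Longrightarrow>
         ennreal (norm (deriv (\<lambda>z. bipoly (refl_coeff c m n) m n z (cis t) / bipoly c m n z (cis t)) (cis s)) powr P) \<le> g t s"
    then show thesis by (rule that[unfolded I_def \<phi>_def])
  qed
  obtain C where C0: "C \<ge> 0"
    "\<And>(q :: nat \<Rightarrow> complex) w f K g. \<lbrakk>\<And>z. norm z < 1 \<Longrightarrow> (\<Sum>j\<le>m. q j * z ^ j) \<noteq> 0; norm w = 1;
       \<And>z. f z = w * (\<Sum>j\<le>m. cnj (q (m - j)) * z ^ j) / (\<Sum>j\<le>m. q j * z ^ j);
       \<And>s. \<lbrakk>s \<in> {0..2*pi}; (\<Sum>j\<le>m. q j * cis s ^ j) \<noteq> 0\<rbrakk> \<Longrightarrow> ennreal (norm (deriv f (cis s)) powr P) \<le> g s\<rbrakk>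
     \<Longrightarrow> ennreal (\<Sum>k<K. (real k + 1) powr P * (norm (taylor_coeff f k))\<^sup>2)
          \<le> ennreal C * (1 + (\<integral>\<^sup>+s\<in>{0..2*pi}. g s \<partial>lborel))"
    using slice_dirichlet_le_circle_integral[OF P, of m] by blast
  note C = C0[folded I_def]
  define a where "a = (\<lambda>k w. taylor_coeff (\<lambda>z. \<phi> z w) k)"
  have slice: "ennreal (\<Sum>k<K. (real k + 1) powr P * (norm (a k (cis t)))\<^sup>2) \<le> ennreal C * (1 + (\<integral>\<^sup>+s\<in>I. g t s \<partial>lborel))"
    if t: "t \<in> I" for t K
    unfolding a_def
  proof (rule C(2)[where q = "slice_coeff c n (cis t)" and w = "cis t ^ n"])
    show "(\<Sum>j\<le>m. slice_coeff c n (cis t) j * z ^ j) \<noteq> 0" if "norm z < 1" for z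
      using bipoly_nonzero_closed[OF nz at that, of "cis t"] by (simp add: bipoly_slice)
    show "norm (cis t ^ n) = 1" by (simp add: norm_power)
    show "\<phi> z (cis t) = cis t ^ n * (\<Sum>j\<le>m. cnj (slice_coeff c n (cis t) (m - j)) * z ^ j) / (\<Sum>j\<le>m. slice_coeff c n (cis t) j * z ^ j)" for z
      unfolding \<phi>_def by (subst bipoly_refl_slice) (simp_all add: bipoly_slice)
    show "ennreal (norm (deriv (\<lambda>z. \<phi> z (cis t)) (cis s)) powr P) \<le> g t s"
      if "s \<in> I" "(\<Sum>j\<le>m. slice_coeff c n (cis t) j * cis s ^ j) \<noteq> 0" for s
      using g(3)[OF that(1) t] that(2) by (simp add: bipoly_slice)
  qed
  have c0: "slice_coeff c n w 0 \<noteq> 0" if "norm w \<le> 1" for w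
    using bipoly_nonzero_closed[OF nz at, of 0 w] that by (simp add: bipoly_at_0)
  have c00: "c 0 0 \<noteq> 0"
    using c0[of 0] by (simp add: slice_coeff_def power_0_left if_distrib sum.delta' cong: if_cong)
  \<comment> \<open>The closed disc is what matters: it leaves room for a radius beyond 1, so
    Parseval applies on the unit circle itself.\<close>
  have "cball 0 1 \<subseteq> {w. slice_coeff c n w 0 \<noteq> 0}" using c0 by auto
  from cball_subset_open_imp_larger_ball[OF _ open_slice_coeff_nonzero this]
  obtain \<rho> where rho: "1 < \<rho>" "ball 0 \<rho> \<subseteq> {w. slice_coeff c n w 0 \<noteq> 0}" by auto
  have ha: "a k holomorphic_on ball 0 \<rho>" for k
    unfolding a_def \<phi>_def by (rule holomorphic_on_subset[OF bipoly_ratio_coeff_holomorphic rho(2)])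
  have ta: "taylor2 \<phi> k l = taylor_coeff (a k) l" for k l
    unfolding a_def \<phi>_def by (rule taylor2_bipoly_ratio(2)) (rule c00)
  \<comment> \<open>\<open>2 * pi\<close> integrates the 1 of the slice estimate;
    \<open>max 0 M\<close> because \<open>ennreal\<close> truncates a negative \<open>M\<close> to
    0.\<close>
  define B where "B = C * (2 * pi + max 0 M)"
  have bound: "2 * pi * (\<Sum>k<K. (real k + 1) powr P * (\<Sum>l<L. (norm (taylor2 \<phi> k l))\<^sup>2)) \<le> B" for K L
  proof -
    define h where "h = (\<lambda>t. \<Sum>k<K. (real k + 1) powr P * (norm (a k (cis t)))\<^sup>2)"
    have ca: "continuous_on A (\<lambda>t. a k (cis t))" for k A
      by (rule continuous_on_subset[OF parseval_partial_sum_le(2)[OF ha rho(1)] subset_UNIV])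
    have ih: "(h has_integral integral I h) I"
      unfolding I_def h_def by (intro integrable_integral integrable_continuous_interval continuous_intros ca)
    have h0: "0 \<le> h t" for t unfolding h_def by (intro sum_nonneg) auto
    have "2 * pi * (\<Sum>k<K. (real k + 1) powr P * (\<Sum>l<L. (norm (taylor2 \<phi> k l))\<^sup>2)) =
        (\<Sum>k<K. (real k + 1) powr P * (2 * pi * (\<Sum>l<L. (norm (taylor_coeff (a k) l))\<^sup>2)))"
      by (simp add: ta sum_distrib_left mult_ac)
    also have "\<dots> \<le> (\<Sum>k<K. (real k + 1) powr P * integral I (\<lambda>t. (norm (a k (cis t)))\<^sup>2))"
      unfolding I_def by (intro sum_mono mult_left_mono parseval_partial_sum_le(1)[OF ha rho(1)]) auto
    also have "\<dots> = integral I h"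
      unfolding h_def I_def
      by (subst integral_sum) (auto intro!: integrable_continuous_interval continuous_intros ca)
    also have "\<dots> \<le> B"
    proof -
      have "ennreal (integral I h) = (\<integral>\<^sup>+t\<in>I. ennreal (h t) \<partial>lborel)"
        by (rule nn_integral_has_integral_lebesgue'[OF h0 ih, symmetric])
      also have "\<dots> \<le> (\<integral>\<^sup>+t\<in>I. ennreal C * (1 + (\<integral>\<^sup>+s\<in>I. g t s \<partial>lborel)) \<partial>lborel)"
        unfolding h_def by (intro nn_integral_mono) (auto simp: slice split: split_indicator)
      also have "\<dots> = (\<integral>\<^sup>+t. ennreal C * (indicator I t + (\<integral>\<^sup>+s\<in>I. g t s \<partial>lborel) * indicator I t) \<partial>lborel)"
        by (intro nn_integral_cong) (auto split: split_indicator)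
      also have "\<dots> = ennreal C * (emeasure lborel I + (\<integral>\<^sup>+t\<in>I. (\<integral>\<^sup>+s\<in>I. g t s \<partial>lborel) \<partial>lborel))"
        using g(1) by (subst nn_integral_cmult, simp add: I_def, subst nn_integral_add) (auto simp: I_def)
      also have "\<dots> \<le> ennreal C * (ennreal (2 * pi) + ennreal M)"
        using g(2) by (intro mult_left_mono add_mono) (auto simp: I_def)
      also have "\<dots> \<le> ennreal C * ennreal (2 * pi + max 0 M)"
        by (subst ennreal_plus) (auto intro!: mult_left_mono add_left_mono ennreal_leI)
      also have "\<dots> = ennreal (C * (2 * pi + max 0 M))" using C(1) by (simp add: ennreal_mult')
      finally show ?thesis
        unfolding B_def using C(1) by (subst (asm) ennreal_le_iff) (auto intro!: mult_nonneg_nonneg add_nonneg_nonneg)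
    qed
    finally show ?thesis .
  qed
  have "(\<lambda>(k, l). (real k + 1) powr P * (real l + 1) powr 0 * (norm (taylor2 \<phi> k l))\<^sup>2) summable_on UNIV"
  proof (rule nonneg_bdd_above_summable_on)
    show "bdd_above (sum (\<lambda>(k, l). (real k + 1) powr P * (real l + 1) powr 0 * (norm (taylor2 \<phi> k l))\<^sup>2) ` {F. F \<subseteq> UNIV \<and> finite F})"
    proof (rule bdd_aboveI2)
      fix F :: "(nat \<times> nat) set" assume "F \<in> {F. F \<subseteq> UNIV \<and> finite F}"
      then have F: "finite F" by simp
      obtain K where K: "fst ` F \<subseteq> {..<K}" using finite_nat_bounded[of "fst ` F"] F by auto
      obtain L where L: "snd ` F \<subseteq> {..<L}" using finite_nat_bounded[of "snd ` F"] F by auto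
      have FKL: "F \<subseteq> {..<K} \<times> {..<L}" using K L by force
      have "sum (\<lambda>(k, l). (real k + 1) powr P * (real l + 1) powr 0 * (norm (taylor2 \<phi> k l))\<^sup>2) F \<le>
          sum (\<lambda>(k, l). (real k + 1) powr P * (real l + 1) powr 0 * (norm (taylor2 \<phi> k l))\<^sup>2) ({..<K} \<times> {..<L})"
        by (rule sum_mono2[OF _ FKL]) auto
      also have "\<dots> = (\<Sum>k<K. (real k + 1) powr P * (\<Sum>l<L. (norm (taylor2 \<phi> k l))\<^sup>2))"
        by (simp add: sum.cartesian_product[symmetric] sum_distrib_left)
      also have "\<dots> \<le> B / (2 * pi)"
        using bound[where K = K and L = L] by (simp add: pos_le_divide_eq mult_ac)
      finally show "sum (\<lambda>(k, l). (real k + 1) powr P * (real l + 1) powr 0 * (norm (taylor2 \<phi> k l))\<^sup>2) F \<le> B / (2 * pi)" .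
    qed
  qed auto
  then show ?thesis
    unfolding dirichlet2_def using holo_bidisc_bipoly_ratio[OF nz, of "refl_coeff c m n"] by (simp add: \<phi>_def)
qed

section \<open>Exchanging the two variables\<close>

lemma refl_coeff_swap: "refl_coeff (\<lambda>i k. c k i) n m = (\<lambda>i k. refl_coeff c m n k i)"
  by (intro ext) (simp add: refl_coeff_def conj_commute)

lemma is_polyfun_swap:
  assumes "is_polyfun f"
  shows "is_polyfun (\<lambda>z w. f w z)"
proof -
  obtain d N where d: "\<And>z w. f z w = bipoly d N N z w" using assms unfolding is_polyfun_def by blast
  have "f w z = bipoly (\<lambda>i k. d k i) N N z w" for z w
    unfolding d by (rule bipoly_swap[symmetric])
  then show ?thesis unfolding is_polyfun_def by blast
qed

lemma atoral_swap:
  assumes "atoral c m n"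
  shows "atoral (\<lambda>i k. c k i) n m"
  unfolding atoral_def refl_coeff_swap[of c n m]
proof clarify
  fix q r s
  assume *: "is_polyfun q" "is_polyfun r" "is_polyfun s" "\<nexists>a. \<forall>z1 z2. q z1 z2 = a"
    and "\<forall>z1 z2. bipoly (\<lambda>i k. c k i) n m z1 z2 = q z1 z2 * r z1 z2"
    and "\<forall>z1 z2. bipoly (\<lambda>i k. refl_coeff c m n k i) n m z1 z2 = q z1 z2 * s z1 z2"
  then have e1: "bipoly c m n z1 z2 = q z2 z1 * r z2 z1"
    and e2: "bipoly (refl_coeff c m n) m n z1 z2 = q z2 z1 * s z2 z1" for z1 z2
    using bipoly_swap[of c n m z2 z1] bipoly_swap[of "refl_coeff c m n" n m z2 z1] by simp_all
  have nc: "\<nexists>a. \<forall>z1 z2. q z2 z1 = a" using *(4) by blast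
  show False
    using assms unfolding atoral_def
    using is_polyfun_swap[OF *(1)] is_polyfun_swap[OF *(2)] is_polyfun_swap[OF *(3)] nc e1 e2 by blast
qed

lemma no_zeros_bidisc_swap:
  assumes "no_zeros_bidisc c m n"
  shows "no_zeros_bidisc (\<lambda>i k. c k i) n m"
  using assms unfolding no_zeros_bidisc_def by (auto simp: bipoly_swap[of c n m])

section \<open>From the Hardy condition to the Dirichlet condition\<close>

lemma hardy2_bound:
  fixes f :: "complex \<Rightarrow> complex \<Rightarrow> complex"
  assumes h: "hardy2 P f"
    and cont: "\<And>r. 0 < r \<Longrightarrow> r < 1 \<Longrightarrow>
        continuous_on UNIV (\<lambda>(s, t). norm (f (of_real r * cis s) (of_real r * cis t)) powr P)"
  shows "\<exists>M. \<forall>r\<in>{0<..<1}. (\<integral>\<^sup>+s\<in>{0..2*pi}. (\<integral>\<^sup>+t\<in>{0..2*pi}.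
      ennreal (norm (f (of_real r * cis s) (of_real r * cis t)) powr P) \<partial>lborel) \<partial>lborel) \<le> ennreal M"
proof -
  define J where "J = (\<lambda>r. LBINT s=0..2*pi. (LBINT t=0..2*pi. norm (f (of_real r * cis s) (of_real r * cis t)) powr P))"
  have "bdd_above ((\<lambda>r. (1 / (4 * pi ^ 2)) * J r) ` {0<..<1})"
    using h unfolding hardy2_def J_def by (rule conjunct2)
  then obtain B where "\<forall>x\<in>(\<lambda>r. (1 / (4 * pi ^ 2)) * J r) ` {0<..<1}. x \<le> B"
    unfolding bdd_above_def by (rule exE)
  then have B: "(1 / (4 * pi ^ 2)) * J r \<le> B" if "0 < r" "r < 1" for r
    using that by simp
  show ?thesis
  proof (intro exI[of _ "4 * pi ^ 2 * B"] ballI)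
    fix r :: real assume "r \<in> {0<..<1}"
    then have r: "0 < r" "r < 1" by auto
    have "J r \<le> 4 * pi ^ 2 * B" using B[OF r] by (simp add: pos_divide_le_eq mult.commute)
    then have "ennreal (J r) \<le> ennreal (4 * pi ^ 2 * B)" by (rule ennreal_leI)
    then show "(\<integral>\<^sup>+s\<in>{0..2*pi}. (\<integral>\<^sup>+t\<in>{0..2*pi}. ennreal (norm (f (of_real r * cis s) (of_real r * cis t)) powr P) \<partial>lborel) \<partial>lborel) \<le> ennreal (4 * pi ^ 2 * B)"
      using iterated_nn_integral_eq_LBINT[OF cont[OF r], of 0 "2 * pi"] by (simp add: J_def zero_ereal_def)
  qed
qed

text \<open>The Hardy condition integrates over the first variable outermost, the slice argument
  over the second; Tonelli exchanges them.\<close>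

lemma dirichlet2_of_hardy2_d1:
  fixes c :: "nat \<Rightarrow> nat \<Rightarrow> complex" and m n :: nat and P :: real
  assumes nz: "no_zeros_bidisc c m n" and at: "atoral c m n" and P: "0 < P"
  defines "\<phi> \<equiv> (\<lambda>z w. bipoly (refl_coeff c m n) m n z w / bipoly c m n z w)"
  assumes h: "hardy2 P (d1 \<phi>)"
  shows "dirichlet2 P 0 \<phi>"
proof -
  have cont: "continuous_on UNIV (\<lambda>(s, t). norm (d1 \<phi> (of_real r * cis s) (of_real r * cis t)) powr P)"
    if "0 < r" "r < 1" for r
    unfolding \<phi>_def by (rule continuous_on_d1_torus[OF nz that P])
  obtain M where M: "\<forall>r\<in>{0<..<1}.
      (\<integral>\<^sup>+s\<in>{0..2*pi}. (\<integral>\<^sup>+t\<in>{0..2*pi}. ennreal (norm (d1 \<phi> (of_real r * cis s) (of_real r * cis t)) powr P) \<partial>lborel) \<partial>lborel) \<le> ennreal M"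
    using hardy2_bound[OF h cont] by (rule exE)
  show ?thesis
  proof (rule dirichlet2_of_d1_bound[OF nz at P, folded \<phi>_def])
    fix r :: real assume r: "0 < r" "r < 1"
    define F where "F = (\<lambda>s t. norm (d1 \<phi> (of_real r * cis s) (of_real r * cis t)) powr P)"
    define G where "G = (\<lambda>s t. ennreal (F s t) * indicator {0..2*pi} t * indicator {0..2*pi} s)"
    have "(\<lambda>x. F (fst x) (snd x)) \<in> borel_measurable borel"
      using cont[OF r] unfolding F_def case_prod_unfold by (rule borel_measurable_continuous_onI)
    then have mF: "(\<lambda>x. F (fst x) (snd x)) \<in> borel_measurable (lborel \<Otimes>\<^sub>M lborel)"
      unfolding lborel_prod by simp
    have mG: "case_prod G \<in> borel_measurable (lborel \<Otimes>\<^sub>M lborel)"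
      unfolding G_def case_prod_unfold
      by (intro borel_measurable_times_ennreal measurable_compose[OF mF measurable_ennreal]) measurable
    have "(\<integral>\<^sup>+t\<in>{0..2*pi}. (\<integral>\<^sup>+s\<in>{0..2*pi}. ennreal (F s t) \<partial>lborel) \<partial>lborel) = (\<integral>\<^sup>+t. (\<integral>\<^sup>+s. G s t \<partial>lborel) \<partial>lborel)"
      by (intro nn_integral_cong) (auto simp: G_def split: split_indicator)
    also have "\<dots> = (\<integral>\<^sup>+s. (\<integral>\<^sup>+t. G s t \<partial>lborel) \<partial>lborel)"
      by (rule lborel_pair.Fubini'[OF mG])
    also have "\<dots> = (\<integral>\<^sup>+s\<in>{0..2*pi}. (\<integral>\<^sup>+t\<in>{0..2*pi}. ennreal (F s t) \<partial>lborel) \<partial>lborel)"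
      by (intro nn_integral_cong) (auto simp: G_def split: split_indicator)
    also have "\<dots> \<le> ennreal M" unfolding F_def using M r by simp
    finally show "(\<integral>\<^sup>+t\<in>{0..2*pi}. (\<integral>\<^sup>+s\<in>{0..2*pi}.
        ennreal (norm (d1 \<phi> (of_real r * cis s) (of_real r * cis t)) powr P) \<partial>lborel) \<partial>lborel) \<le> ennreal M"
      unfolding F_def .
  qed
qed

text \<open>Transposing the coefficients turns d2 into d1. The exchange of arguments also puts the
  integrals into the order that \<open>dirichlet2_of_d1_bound\<close> expects, so Tonelli is not
  called upon here.\<close>

lemma dirichlet2_of_hardy2_d2:
  fixes c :: "nat \<Rightarrow> nat \<Rightarrow> complex" and m n :: nat and P :: real
  assumes nz: "no_zeros_bidisc c m n" and at: "atoral c m n" and P: "0 < P"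
  defines "\<phi> \<equiv> (\<lambda>z w. bipoly (refl_coeff c m n) m n z w / bipoly c m n z w)"
  assumes h: "hardy2 P (d2 \<phi>)"
  shows "dirichlet2 0 P \<phi>"
proof -
  define c' where "c' = (\<lambda>i k. c k i)"
  define \<psi> where "\<psi> = (\<lambda>z w. bipoly (refl_coeff c' n m) n m z w / bipoly c' n m z w)"
  have nz': "no_zeros_bidisc c' n m" unfolding c'_def by (rule no_zeros_bidisc_swap[OF nz])
  have at': "atoral c' n m" unfolding c'_def by (rule atoral_swap[OF at])
  have psi: "\<psi> z w = \<phi> w z" for z w
    unfolding \<psi>_def \<phi>_def c'_def refl_coeff_swap[of c n m]
    by (simp only: bipoly_swap[of c n m z w] bipoly_swap[of "refl_coeff c m n" n m z w])
  have d12: "d2 \<phi> z w = d1 \<psi> w z" for z w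
    unfolding d1_def d2_def psi ..
  have cont: "continuous_on UNIV (\<lambda>(s, t). norm (d2 \<phi> (of_real r * cis s) (of_real r * cis t)) powr P)"
    if "0 < r" "r < 1" for r
  proof -
    have "continuous_on UNIV (\<lambda>x. (case (snd x, fst x) of (s, t) \<Rightarrow> norm (d1 \<psi> (of_real r * cis s) (of_real r * cis t)) powr P))"
      by (rule continuous_on_compose2[OF continuous_on_d1_torus[OF nz' that P, of "refl_coeff c' n m", folded \<psi>_def]])
         (auto intro!: continuous_intros)
    then show ?thesis unfolding d12 by (simp add: case_prod_unfold)
  qed
  obtain M where M: "\<forall>r\<in>{0<..<1}.
      (\<integral>\<^sup>+s\<in>{0..2*pi}. (\<integral>\<^sup>+t\<in>{0..2*pi}. ennreal (norm (d2 \<phi> (of_real r * cis s) (of_real r * cis t)) powr P) \<partial>lborel) \<partial>lborel) \<le> ennreal M"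
    using hardy2_bound[OF h cont] by (rule exE)
  have D: "dirichlet2 P 0 \<psi>"
    by (rule dirichlet2_of_d1_bound[OF nz' at' P, folded \<psi>_def, where M = M])
       (use M[unfolded d12] in simp)
  have "c 0 0 \<noteq> 0"
    using nz[unfolded no_zeros_bidisc_def, rule_format, of 0 0]
    by (simp add: bipoly_at_0 slice_coeff_def power_0_left if_distrib sum.delta' cong: if_cong)
  then have c00: "c 0 0 \<noteq> 0" "c' 0 0 \<noteq> 0" by (simp_all add: c'_def)
  have tay: "taylor2 \<psi> l k = taylor2 \<phi> k l" for k l
  proof -
    have "taylor2 \<psi> l k = taylor_coeff (\<lambda>w. taylor_coeff (\<lambda>z. \<psi> z w) l) k"
      unfolding \<psi>_def by (rule taylor2_bipoly_ratio(2)) (rule c00)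
    \<comment> \<open>Exchanging the arguments maps the z1-first expansion of \<open>\<psi>\<close>
      to the z2-first expansion of \<open>\<phi>\<close>; hence both parts of
      \<open>taylor2_bipoly_ratio\<close> are used.\<close>
    also have "\<dots> = taylor_coeff (\<lambda>z. taylor_coeff (\<lambda>w. \<phi> z w) l) k" unfolding psi ..
    also have "\<dots> = taylor2 \<phi> k l"
      unfolding \<phi>_def by (rule taylor2_bipoly_ratio(1)[symmetric]) (rule c00)
    finally show ?thesis .
  qed
  have "(\<lambda>(k, l). (real k + 1) powr P * (real l + 1) powr 0 * (norm (taylor2 \<psi> k l))\<^sup>2) summable_on UNIV"
    using D by (simp add: dirichlet2_def)
  then have "(\<lambda>(k, l). (real k + 1) powr P * (real l + 1) powr 0 * (norm (taylor2 \<psi> k l))\<^sup>2) summable_on (prod.swap ` UNIV)"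
    by simp
  then have "((\<lambda>(k, l). (real k + 1) powr P * (real l + 1) powr 0 * (norm (taylor2 \<psi> k l))\<^sup>2) \<circ> prod.swap) summable_on UNIV"
    by (subst (asm) summable_on_reindex) auto
  then have "(\<lambda>(k, l). (real k + 1) powr 0 * (real l + 1) powr P * (norm (taylor2 \<phi> k l))\<^sup>2) summable_on UNIV"
    by (simp add: o_def case_prod_unfold tay mult_ac)
  then show ?thesis
    unfolding dirichlet2_def using holo_bidisc_bipoly_ratio[OF nz, of "refl_coeff c m n"] by (simp add: \<phi>_def)
qed

theorem theorem9p1:
  fixes c :: "nat \<Rightarrow> nat \<Rightarrow> complex" and m n :: nat and P :: real
  assumes "has_bidegree c m n"
    and "no_zeros_bidisc c m n"
    and "atoral c m n"
    and "0 < P"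
  defines "\<phi> \<equiv> (\<lambda>z1 z2. bipoly (refl_coeff c m n) m n z1 z2 / bipoly c m n z1 z2)"
  shows "(hardy2 P (d1 \<phi>) \<longrightarrow> dirichlet2 P 0 \<phi>) \<and> (hardy2 P (d2 \<phi>) \<longrightarrow> dirichlet2 0 P \<phi>)"
  unfolding \<phi>_def
  using dirichlet2_of_hardy2_d1[OF assms(2-4)] dirichlet2_of_hardy2_d2[OF assms(2-4)] by blast

end
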